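(* Let $q\in\mathbb{C}^*$ be generic. The category $\mathcal{C}$ of admissible $\mathcal{A}_q(2)$-modules can be expressed as $$\mathcal{C}=\bigoplus_{(a,b)\in\mathcal{P}}\mathcal{C}_{(a,b)},$$ that is, the objects of $\mathcal{C}$ are finite direct sums of objects of the full subcategories $\mathcal{C}_{(a,b)}$, $(a,b)\in\mathcal{P}$, and all homomorphisms between objects belonging to different subcategories $\mathcal{C}_{(a,b)}\neq\mathcal{C}_{(a',b')}$ (with $(a,b)\ne(a',b')$ in $\mathcal{P}$) are zero.
   Context: Generic means that $q$ is not a root of unity; $\mathbb{Z}_+$ denotes the non-negative integers. $\mathcal{A}_q(2)$ is the associative unital $\mathbb{C}$-algebra generated by $x,y$ with relation $xy=q\,yx$. Modules are left modules. For $(m,n)\in\mathbb{Z}_+^2\setminus\{(0,0)\}$ and $D=x^my^n$, an $\mathcal{A}_q(2)$-module $M$ is locally $D$-finite if $\mathbb{C}[D]w$ is finite dimensional for every $w\in M$; $\widetilde{\mathcal{C}}_{(m,n)}$ is the category of locally $D$-finite $\mathcal{A}_q(2)$-modules. Let $\widetilde{\mathcal{A}}^{(1,1)}_q$ be the localisation of $\mathcal{A}_q(2)$ at $\{1,K,K^2,\dots\}$ with $K=xy$ (well defined since $K$ quasi-commutes with monomials). For an $\mathcal{A}_q(2)$-module $M$ put $\widetilde{M}^{(1,1)}=\widetilde{\mathcal{A}}^{(1,1)}_q\otimes_{\mathcal{A}_q(2)}M$ and let $\kappa^{(1,1)}:M\to\widetilde{M}^{(1,1)}$, $v\mapsto1\otimes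 v$. An $\mathcal{A}_q(2)$-module $M$ is admissible if there are finitely many submodules $M_j\subset M$ with $M=\sum_jM_j$ such that (i) each $M_j\in\widetilde{\mathcal{C}}_{(m_j,n_j)}$ for some $(m_j,n_j)\in\mathbb{Z}_+^2\setminus\{(0,0)\}$, and (ii) $\kappa^{(1,1)}:M\to\widetilde{M}^{(1,1)}$ is injective. $\mathcal{C}$ is the category of admissible modules, and $\mathcal{C}_{(m,n)}$ is the full subcategory of $\widetilde{\mathcal{C}}_{(m,n)}$ consisting of admissible objects. $\mathcal{P}=\{(a,b)\in\mathbb{Z}_+^2\setminus\{(0,0)\}\mid\gcd(a,b)=1\}$; in particular, the only elements with a zero entry are $(1,0)$ and $(0,1)$. *)

theory Defs
  imports Complex_Main "HOL-Algebra.Algebra" "HOL-Library.Poly_Mapping"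
begin

section \<open>Rings given by generators and relations\<close>

text \<open>Words form the free monoid, written additively because \<^typ>\<open>'a \<Rightarrow>\<^sub>0 'b\<close> uses addition
  on its keys for the convolution product.\<close>

datatype 'g fword = Word (letters: "'g list")

instantiation fword :: (type) monoid_add
begin

definition zero_fword :: "'g fword" where "zero_fword = Word []"

definition plus_fword :: "'g fword \<Rightarrow> 'g fword \<Rightarrow> 'g fword"
  where "plus_fword u v = Word (letters u @ letters v)"

instance by standard (simp_all add: zero_fword_def plus_fword_def)

end

abbreviation fmon :: "'g list \<Rightarrow> 'k::zero \<Rightarrow> 'g fword \<Rightarrow>\<^sub>0 'k"
  where "fmon u c \<equiv> Poly_Mapping.single (Word u) c"

text \<open>The coefficients \<open>fmon [] c\<close> are central in the free algebra, so its two-sided ideals are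
  linear subspaces and \<open>presented\<close> is the quotient as an algebra over \<open>'k\<close>.\<close>

definition free_alg :: "'g set \<Rightarrow> ('g fword \<Rightarrow>\<^sub>0 'k::comm_ring_1) ring"
  where "free_alg G =
    \<lparr>carrier = {p. \<forall>w\<in>Poly_Mapping.keys p. set (letters w) \<subseteq> G},
     monoid.mult = (*), one = 1, ring.zero = 0, ring.add = (+)\<rparr>"

definition presented :: "'g set \<Rightarrow> ('g fword \<Rightarrow>\<^sub>0 'k::comm_ring_1) set \<Rightarrow> ('g fword \<Rightarrow>\<^sub>0 'k) set ring"
  where "presented G rels = free_alg G Quot (genideal (free_alg G) rels)"

definition pclass :: "'g set \<Rightarrow> ('g fword \<Rightarrow>\<^sub>0 'k::comm_ring_1) set \<Rightarrow> ('g fword \<Rightarrow>\<^sub>0 'k)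
    \<Rightarrow> ('g fword \<Rightarrow>\<^sub>0 'k) set"
  where "pclass G rels p = genideal (free_alg G) rels +>\<^bsub>free_alg G\<^esub> p"


section \<open>Localisation of a ring\<close>

text \<open>The universal ring over \<open>R\<close> in which the elements of \<open>S\<close> become invertible: the generators are
  the elements of \<open>R\<close>, subject to all relations holding in \<open>R\<close>, together with formal two-sided
  inverses of the elements of \<open>S\<close>.  It is the ring of Ore fractions whenever \<open>S\<close> is a denominator
  set.\<close>

datatype 'a loc_gen = Elt 'a | Inv 'a

definition loc_gens :: "('a, 'm) ring_scheme \<Rightarrow> 'a set \<Rightarrow> 'a loc_gen set"
  where "loc_gens R S = Elt ` carrier R \<union> Inv ` S"

definition loc_rels :: "('a, 'm) ring_scheme \<Rightarrow> 'a set \<Rightarrow> ('a loc_gen fword \<Rightarrow>\<^sub>0 int) set"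
  where "loc_rels R S =
      {fmon [Elt \<one>\<^bsub>R\<^esub>] 1 - 1}
    \<union> {fmon [Elt a] 1 + fmon [Elt b] 1 - fmon [Elt (a \<oplus>\<^bsub>R\<^esub> b)] 1 | a b. a \<in> carrier R \<and> b \<in> carrier R}
    \<union> {fmon [Elt a, Elt b] 1 - fmon [Elt (a \<otimes>\<^bsub>R\<^esub> b)] 1 | a b. a \<in> carrier R \<and> b \<in> carrier R}
    \<union> {fmon [Elt s, Inv s] 1 - 1 | s. s \<in> S}
    \<union> {fmon [Inv s, Elt s] 1 - 1 | s. s \<in> S}"

definition localisation :: "('a, 'm) ring_scheme \<Rightarrow> 'a set \<Rightarrow> ('a loc_gen fword \<Rightarrow>\<^sub>0 int) set ring"
  where "localisation R S = presented (loc_gens R S) (loc_rels R S)"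

definition loc_map :: "('a, 'm) ring_scheme \<Rightarrow> 'a set \<Rightarrow> 'a \<Rightarrow> ('a loc_gen fword \<Rightarrow>\<^sub>0 int) set"
  where "loc_map R S a = pclass (loc_gens R S) (loc_rels R S) (fmon [Elt a] 1)"


section \<open>Left modules over a not necessarily commutative ring\<close>

locale left_module = R?: ring R + M?: abelian_group M
  for R :: "('a, 'm) ring_scheme" (structure) and M :: "('a, 'b, 'n) module_scheme" (structure) +
  assumes smult_closed: "\<lbrakk>a \<in> carrier R; v \<in> carrier M\<rbrakk> \<Longrightarrow> a \<odot>\<^bsub>M\<^esub> v \<in> carrier M"
    and smult_l_distr: "\<lbrakk>a \<in> carrier R; b \<in> carrier R; v \<in> carrier M\<rbrakk> \<Longrightarrow>
      (a \<oplus>\<^bsub>R\<^esub> b) \<odot>\<^bsub>M\<^esub> v = a \<odot>\<^bsub>M\<^esub> v \<oplus>\<^bsub>M\<^esub> b \<odot>\<^bsub>M\<^esub> v"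
    and smult_r_distr: "\<lbrakk>a \<in> carrier R; v \<in> carrier M; w \<in> carrier M\<rbrakk> \<Longrightarrow>
      a \<odot>\<^bsub>M\<^esub> (v \<oplus>\<^bsub>M\<^esub> w) = a \<odot>\<^bsub>M\<^esub> v \<oplus>\<^bsub>M\<^esub> a \<odot>\<^bsub>M\<^esub> w"
    and smult_assoc: "\<lbrakk>a \<in> carrier R; b \<in> carrier R; v \<in> carrier M\<rbrakk> \<Longrightarrow>
      (a \<otimes>\<^bsub>R\<^esub> b) \<odot>\<^bsub>M\<^esub> v = a \<odot>\<^bsub>M\<^esub> (b \<odot>\<^bsub>M\<^esub> v)"
    and smult_one: "v \<in> carrier M \<Longrightarrow> \<one>\<^bsub>R\<^esub> \<odot>\<^bsub>M\<^esub> v = v"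

definition left_module_hom :: "('a, 'm) ring_scheme \<Rightarrow> ('a, 'b) module \<Rightarrow> ('a, 'c) module \<Rightarrow> ('b \<Rightarrow> 'c) set"
  where "left_module_hom R M M' = {f \<in> carrier M \<rightarrow> carrier M'.
      (\<forall>v\<in>carrier M. \<forall>w\<in>carrier M. f (v \<oplus>\<^bsub>M\<^esub> w) = f v \<oplus>\<^bsub>M'\<^esub> f w)
    \<and> (\<forall>a\<in>carrier R. \<forall>v\<in>carrier M. f (a \<odot>\<^bsub>M\<^esub> v) = a \<odot>\<^bsub>M'\<^esub> f v)}"

definition sum_of :: "('a, 'b) module \<Rightarrow> 'i set \<Rightarrow> ('i \<Rightarrow> 'b set) \<Rightarrow> 'b set"
  where "sum_of M I N = {finsum M v I | v. v \<in> Pi I N}"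

text \<open>Finite internal direct sum of submodules.\<close>

definition direct_sum :: "('a, 'm) ring_scheme \<Rightarrow> ('a, 'b) module \<Rightarrow> 'i set \<Rightarrow> ('i \<Rightarrow> 'b set) \<Rightarrow> bool"
  where "direct_sum R M I N \<longleftrightarrow> left_module R M \<and> finite I
    \<and> (\<forall>i\<in>I. submodule (N i) R M)
    \<and> carrier M = sum_of M I N
    \<and> (\<forall>v\<in>Pi I N. finsum M v I = \<zero>\<^bsub>M\<^esub> \<longrightarrow> (\<forall>i\<in>I. v i = \<zero>\<^bsub>M\<^esub>))"

text \<open>The underlying abelian group of \<open>B \<otimes>\<^sub>R M\<close>, where \<open>B\<close> is a right \<open>R\<close>-module through
  \<open>\<phi> : R \<rightarrow> B\<close>; as a quotient of \<^const>\<open>free_Abelian_group\<close> it is written multiplicatively.\<close>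

definition tensor_rels :: "('a, 'm) ring_scheme \<Rightarrow> 'c ring \<Rightarrow> ('a \<Rightarrow> 'c) \<Rightarrow> ('a, 'b) module
    \<Rightarrow> ('c \<times> 'b \<Rightarrow>\<^sub>0 int) set"
  where "tensor_rels R B \<phi> M =
      {frag_of (b \<oplus>\<^bsub>B\<^esub> b', v) - frag_of (b, v) - frag_of (b', v) | b b' v.
         b \<in> carrier B \<and> b' \<in> carrier B \<and> v \<in> carrier M}
    \<union> {frag_of (b, v \<oplus>\<^bsub>M\<^esub> w) - frag_of (b, v) - frag_of (b, w) | b v w.
         b \<in> carrier B \<and> v \<in> carrier M \<and> w \<in> carrier M}
    \<union> {frag_of (b \<otimes>\<^bsub>B\<^esub> \<phi> a, v) - frag_of (b, a \<odot>\<^bsub>M\<^esub> v) | b a v.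
         b \<in> carrier B \<and> a \<in> carrier R \<and> v \<in> carrier M}"

definition tensor_subgroup :: "('a, 'm) ring_scheme \<Rightarrow> 'c ring \<Rightarrow> ('a \<Rightarrow> 'c) \<Rightarrow> ('a, 'b) module
    \<Rightarrow> ('c \<times> 'b \<Rightarrow>\<^sub>0 int) set"
  where "tensor_subgroup R B \<phi> M =
    generate (free_Abelian_group (carrier B \<times> carrier M)) (tensor_rels R B \<phi> M)"

definition tensor :: "('a, 'm) ring_scheme \<Rightarrow> 'c ring \<Rightarrow> ('a \<Rightarrow> 'c) \<Rightarrow> ('a, 'b) module
    \<Rightarrow> ('c \<times> 'b \<Rightarrow>\<^sub>0 int) set monoid"
  where "tensor R B \<phi> M =
    free_Abelian_group (carrier B \<times> carrier M) Mod tensor_subgroup R B \<phi> M"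

definition pure_tensor :: "('a, 'm) ring_scheme \<Rightarrow> 'c ring \<Rightarrow> ('a \<Rightarrow> 'c) \<Rightarrow> ('a, 'b) module
    \<Rightarrow> 'c \<Rightarrow> 'b \<Rightarrow> ('c \<times> 'b \<Rightarrow>\<^sub>0 int) set"
  where "pure_tensor R B \<phi> M b v =
    tensor_subgroup R B \<phi> M #>\<^bsub>free_Abelian_group (carrier B \<times> carrier M)\<^esub> frag_of (b, v)"


section \<open>The quantum plane\<close>

datatype gen = GenX | GenY

type_synonym qplane = "(gen fword \<Rightarrow>\<^sub>0 complex) set"

definition qplane_rels :: "complex \<Rightarrow> (gen fword \<Rightarrow>\<^sub>0 complex) set"
  where "qplane_rels q = {fmon [GenX, GenY] 1 - fmon [GenY, GenX] q}"

definition Aq :: "complex \<Rightarrow> qplane ring"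
  where "Aq q = presented UNIV (qplane_rels q)"

definition scal :: "complex \<Rightarrow> complex \<Rightarrow> qplane"
  where "scal q c = pclass UNIV (qplane_rels q) (fmon [] c)"

definition xgen :: "complex \<Rightarrow> qplane"
  where "xgen q = pclass UNIV (qplane_rels q) (fmon [GenX] 1)"

definition ygen :: "complex \<Rightarrow> qplane"
  where "ygen q = pclass UNIV (qplane_rels q) (fmon [GenY] 1)"

definition qmon :: "complex \<Rightarrow> nat \<times> nat \<Rightarrow> qplane"
  where "qmon q p = xgen q [^]\<^bsub>Aq q\<^esub> fst p \<otimes>\<^bsub>Aq q\<^esub> ygen q [^]\<^bsub>Aq q\<^esub> snd p"

definition generic :: "complex \<Rightarrow> bool"
  where "generic q \<longleftrightarrow> (\<forall>n::nat. n > 0 \<longrightarrow> q ^ n \<noteq> 1)"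

text \<open>Here \<open>W\<close> is a complex subspace of an \<open>\<A>\<^sub>q(2)\<close>-module, \<open>\<complex>\<close> acting through \<^const>\<open>scal\<close>.\<close>

definition finite_dim :: "complex \<Rightarrow> (qplane, 'b) module \<Rightarrow> 'b set \<Rightarrow> bool"
  where "finite_dim q M W \<longleftrightarrow>
    (\<exists>B. finite B \<and> B \<subseteq> W \<and> W = {finsum M (\<lambda>b. scal q (c b) \<odot>\<^bsub>M\<^esub> b) B | c. True})"

definition poly_subalgebra :: "complex \<Rightarrow> qplane \<Rightarrow> qplane set"
  where "poly_subalgebra q D = generate_ring (Aq q) (insert D (range (scal q)))"

definition locally_finite :: "complex \<Rightarrow> qplane \<Rightarrow> (qplane, 'b) module \<Rightarrow> bool"
  where "locally_finite q D M \<longleftrightarrow>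
    (\<forall>w\<in>carrier M. finite_dim q M ((\<lambda>a. a \<odot>\<^bsub>M\<^esub> w) ` poly_subalgebra q D))"

definition catC_tilde :: "complex \<Rightarrow> nat \<times> nat \<Rightarrow> (qplane, 'b) module \<Rightarrow> bool"
  where "catC_tilde q p M \<longleftrightarrow> left_module (Aq q) M \<and> locally_finite q (qmon q p) M"

definition Kpowers :: "complex \<Rightarrow> qplane set"
  where "Kpowers q = {qmon q (1, 1) [^]\<^bsub>Aq q\<^esub> n | n::nat. True}"

abbreviation Aq_loc :: "complex \<Rightarrow> (qplane loc_gen fword \<Rightarrow>\<^sub>0 int) set ring"
  where "Aq_loc q \<equiv> localisation (Aq q) (Kpowers q)"

abbreviation module_loc :: "complex \<Rightarrow> (qplane, 'b) module
    \<Rightarrow> ((qplane loc_gen fword \<Rightarrow>\<^sub>0 int) set \<times> 'b \<Rightarrow>\<^sub>0 int) set monoid"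
  where "module_loc q M \<equiv> tensor (Aq q) (Aq_loc q) (loc_map (Aq q) (Kpowers q)) M"

text \<open>\<open>\<kappa>\<close> is the map \<open>v \<mapsto> 1 \<otimes> v\<close>; only its injectivity is needed, hence the module structure of
  \<^const>\<open>tensor\<close> over the localisation is not recorded.\<close>

definition kappa :: "complex \<Rightarrow> (qplane, 'b) module
    \<Rightarrow> 'b \<Rightarrow> ((qplane loc_gen fword \<Rightarrow>\<^sub>0 int) set \<times> 'b \<Rightarrow>\<^sub>0 int) set"
  where "kappa q M v =
    pure_tensor (Aq q) (Aq_loc q) (loc_map (Aq q) (Kpowers q)) M \<one>\<^bsub>Aq_loc q\<^esub> v"

definition admissible :: "complex \<Rightarrow> (qplane, 'b) module \<Rightarrow> bool"
  where "admissible q M \<longleftrightarrow> left_module (Aq q) M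
    \<and> (\<exists>(k::nat) N d. carrier M = sum_of M {..<k} N
        \<and> (\<forall>j<k. submodule (N j) (Aq q) M
             \<and> d j \<noteq> (0, 0) \<and> catC_tilde q (d j) (M\<lparr>carrier := N j\<rparr>)))
    \<and> inj_on (kappa q M) (carrier M)"

definition catC :: "complex \<Rightarrow> nat \<times> nat \<Rightarrow> (qplane, 'b) module \<Rightarrow> bool"
  where "catC q p M \<longleftrightarrow> catC_tilde q p M \<and> admissible q M"

definition primitive_pairs :: "(nat \<times> nat) set"
  where "primitive_pairs = {(a, b). (a, b) \<noteq> (0, 0) \<and> gcd a b = 1}"

end

theory Submission
  imports Defs "HOL-Computational_Algebra.Fundamental_Theorem_Algebra"
begin

text \<open>Injectivity of \<open>\<kappa>\<close> makes \<open>K = x y\<close>, hence \<open>x\<close>, \<open>y\<close> and every monomial, act injectively,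
  because \<open>v = K\<inverse> \<otimes> K v\<close> in the localisation.  Local \<open>D\<close>-finiteness means that every vector is killed
  by some \<open>P(D) \<noteq> 0\<close>, and this condition for \<open>(k a, k b)\<close> implies it for \<open>(a, b)\<close>, as \<open>x\<^sup>k\<^sup>a y\<^sup>k\<^sup>b\<close> is
  a nonzero multiple of \<open>(x\<^sup>a y\<^sup>b)\<^sup>k\<close>.

  For distinct primitive \<open>p\<close> and \<open>r\<close> one has \<open>D\<^sub>p D\<^sub>r = c D\<^sub>r D\<^sub>p\<close> with \<open>c\<close> not a root of unity.  If
  \<open>D\<^sub>p u = l u\<close> with \<open>u \<noteq> 0\<close>, the vectors \<open>D\<^sub>r\<^sup>n u\<close> are nonzero \<open>D\<^sub>p\<close>-eigenvectors with distinct eigenvalues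
  \<open>c\<^sup>n l\<close>, so \<open>u\<close> is not \<open>D\<^sub>r\<close>-finite.  Hence the maximal submodules of \<open>M\<close> on which \<open>D\<^sub>p\<close> is locally
  finite are independent, and they exhaust an admissible \<open>M\<close>.\<close>

section \<open>Presented rings\<close>

lemma
  shows free_alg_minus: "p \<in> carrier (free_alg G) \<Longrightarrow> - p \<in> carrier (free_alg G)"
    and free_alg_plus: "p \<in> carrier (free_alg G) \<Longrightarrow> r \<in> carrier (free_alg G) \<Longrightarrow> p + r \<in> carrier (free_alg G)"
    and free_alg_diff: "p \<in> carrier (free_alg G) \<Longrightarrow> r \<in> carrier (free_alg G) \<Longrightarrow> p - r \<in> carrier (free_alg G)"
    and free_alg_times: "p \<in> carrier (free_alg G) \<Longrightarrow> r \<in> carrier (free_alg G) \<Longrightarrow> p * r \<in> carrier (free_alg G)"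
    and free_alg_0: "0 \<in> carrier (free_alg G)"
    and free_alg_1: "1 \<in> carrier (free_alg G)"
    and free_alg_fmon: "set u \<subseteq> G \<Longrightarrow> fmon u c \<in> carrier (free_alg G)"
proof -
  show "p * r \<in> carrier (free_alg G)" if "p \<in> carrier (free_alg G)" "r \<in> carrier (free_alg G)"
  proof -
    have "set (letters w) \<subseteq> G" if w: "w \<in> Poly_Mapping.keys (p * r)" for w
    proof -
      obtain u v where "w = u + v" "u \<in> Poly_Mapping.keys p" "v \<in> Poly_Mapping.keys r"
        using w keys_mult[of p r] by blast
      then show ?thesis
        using \<open>p \<in> carrier (free_alg G)\<close> \<open>r \<in> carrier (free_alg G)\<close>
        by (simp add: plus_fword_def free_alg_def)
    qed
    then show ?thesis by (simp add: free_alg_def)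
  qed
  show "p + r \<in> carrier (free_alg G)" if "p \<in> carrier (free_alg G)" "r \<in> carrier (free_alg G)"
    using that keys_add[of p r] by (auto simp: free_alg_def)
  show "p - r \<in> carrier (free_alg G)" if "p \<in> carrier (free_alg G)" "r \<in> carrier (free_alg G)"
    using that keys_diff[of p r] by (auto simp: free_alg_def)
  show "1 \<in> carrier (free_alg G)"
    by (simp add: free_alg_def zero_fword_def flip: single_one)
qed (auto simp: free_alg_def)

lemma ring_free_alg: "ring (free_alg G)"
proof (intro ringI abelian_groupI monoidI)
  fix p :: "'a fword \<Rightarrow>\<^sub>0 'b" assume "p \<in> carrier (free_alg G)"
  then show "\<exists>y\<in>carrier (free_alg G). y \<oplus>\<^bsub>free_alg G\<^esub> p = \<zero>\<^bsub>free_alg G\<^esub>"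
    by (intro bexI[of _ "- p"] free_alg_minus) (simp_all add: free_alg_def)
qed (use free_alg_plus free_alg_times free_alg_0 free_alg_1 in
    \<open>simp_all add: free_alg_def algebra_simps\<close>)

lemma ideal_genideal_free_alg:
  assumes "rels \<subseteq> carrier (free_alg G)"
  shows "ideal (genideal (free_alg G) rels) (free_alg G)"
  by (rule ring.genideal_ideal[OF ring_free_alg assms])

lemma ring_presented:
  "rels \<subseteq> carrier (free_alg G) \<Longrightarrow> ring (presented G rels)"
  unfolding presented_def by (intro ideal.quotient_is_ring ideal_genideal_free_alg)

lemma pclass_hom:
  "rels \<subseteq> carrier (free_alg G) \<Longrightarrow> pclass G rels \<in> ring_hom (free_alg G) (presented G rels)"
  using ideal.rcos_ring_hom[OF ideal_genideal_free_alg]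
  by (auto simp: presented_def pclass_def[abs_def])

lemma
  assumes "rels \<subseteq> carrier (free_alg G)"
  shows pclass_closed: "p \<in> carrier (free_alg G) \<Longrightarrow> pclass G rels p \<in> carrier (presented G rels)"
    and pclass_mult: "p \<in> carrier (free_alg G) \<Longrightarrow> r \<in> carrier (free_alg G) \<Longrightarrow>
      pclass G rels (p * r) = pclass G rels p \<otimes>\<^bsub>presented G rels\<^esub> pclass G rels r"
    and pclass_add: "p \<in> carrier (free_alg G) \<Longrightarrow> r \<in> carrier (free_alg G) \<Longrightarrow>
      pclass G rels (p + r) = pclass G rels p \<oplus>\<^bsub>presented G rels\<^esub> pclass G rels r"
    and pclass_one: "pclass G rels 1 = \<one>\<^bsub>presented G rels\<^esub>"
  using ring_hom_closed[OF pclass_hom[OF assms]] ring_hom_mult[OF pclass_hom[OF assms]]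
    ring_hom_add[OF pclass_hom[OF assms]] ring_hom_one[OF pclass_hom[OF assms]]
  by (auto simp: free_alg_def)

text \<open>The bridge from a defining relation to an equation in the quotient: the difference lies
  in the generated ideal, whose coset is zero.\<close>

lemma pclass_eqI:
  assumes rels: "rels \<subseteq> carrier (free_alg G)"
    and "p - r \<in> rels" "p \<in> carrier (free_alg G)" "r \<in> carrier (free_alg G)"
  shows "pclass G rels p = pclass G rels r"
proof -
  interpret R: ring "free_alg G" by (rule ring_free_alg)
  interpret I: ideal "genideal (free_alg G) rels" "free_alg G"
    by (rule ideal_genideal_free_alg[OF rels])
  interpret P: ring "presented G rels" by (rule ring_presented[OF rels])
  have d: "p - r \<in> genideal (free_alg G) rels" using R.genideal_self[OF rels] assms(2) by blast
  then have c: "p - r \<in> carrier (free_alg G)" using I.a_subset by blast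
  have "pclass G rels (p - r) = \<zero>\<^bsub>presented G rels\<^esub>"
    using I.a_rcos_const[OF d]
    by (simp add: pclass_def presented_def FactRing_def)
  then show ?thesis
    using pclass_add[OF rels c assms(4)] pclass_closed[OF rels assms(4)] by simp
qed

section \<open>Localisation: formal inverses become inverses in the quotient\<close>

lemma loc_rels_subset: "ring R \<Longrightarrow> S \<subseteq> carrier R \<Longrightarrow> loc_rels R S \<subseteq> carrier (free_alg (loc_gens R S))"
proof -
  assume "ring R" and S: "S \<subseteq> carrier R"
  then interpret ring R by simp
  let ?F = "free_alg (loc_gens R S) :: (_ \<Rightarrow>\<^sub>0 int) ring"
  show ?thesis
    using S unfolding loc_rels_def
    by (auto intro!: free_alg_diff free_alg_plus free_alg_fmon free_alg_1)
      (auto simp: loc_gens_def)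
qed

lemma ring_localisation: "ring R \<Longrightarrow> S \<subseteq> carrier R \<Longrightarrow> ring (localisation R S)"
  unfolding localisation_def by (intro ring_presented loc_rels_subset)

lemma loc_map_closed:
  "ring R \<Longrightarrow> S \<subseteq> carrier R \<Longrightarrow> a \<in> carrier R \<Longrightarrow> loc_map R S a \<in> carrier (localisation R S)"
  unfolding localisation_def loc_map_def
  by (intro pclass_closed loc_rels_subset) (auto simp: free_alg_def loc_gens_def)

text \<open>The class of the formal generator \<open>Inv s\<close> does it, by one of the imposed
  relations. A left inverse \<open>b\<close> is what a tensor product with a left module calls for:
  \<open>1 (x) v\<close> becomes \<open>b (x) s v\<close>.\<close>

lemma loc_map_left_inverse:
  assumes R: "ring R" and S: "S \<subseteq> carrier R" and s: "s \<in> S"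
  shows "\<exists>b\<in>carrier (localisation R S). b \<otimes>\<^bsub>localisation R S\<^esub> loc_map R S s = \<one>\<^bsub>localisation R S\<^esub>"
proof -
  let ?F = "free_alg (loc_gens R S) :: (_ \<Rightarrow>\<^sub>0 int) ring"
  note rels = loc_rels_subset[OF R S]
  have car: "fmon [Inv s] 1 \<in> carrier ?F" "fmon [Elt s] 1 \<in> carrier ?F"
    "fmon [Inv s, Elt s] 1 \<in> carrier ?F" "1 \<in> carrier ?F"
    using s S by (auto intro!: free_alg_fmon free_alg_1 imageI simp: loc_gens_def)
  have "fmon [Inv s, Elt s] 1 - 1 \<in> loc_rels R S"
    using s by (auto simp: loc_rels_def)
  from pclass_eqI[OF rels this car(3,4)]
  have "pclass (loc_gens R S) (loc_rels R S) (fmon [Inv s] 1 * fmon [Elt s] 1) = \<one>\<^bsub>localisation R S\<^esub>"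
    by (simp add: pclass_one[OF rels] localisation_def mult_single plus_fword_def)
  then show ?thesis
    using pclass_mult[OF rels car(1,2)] pclass_closed[OF rels car(1)]
    by (auto simp: localisation_def loc_map_def)
qed

section \<open>The quantum plane\<close>

lemma ring_Aq: "ring (Aq q)"
  unfolding Aq_def by (rule ring_presented) (simp add: free_alg_def)

interpretation Aq: ring "Aq q" for q
  by (rule ring_Aq)

lemma free_alg_UNIV: "carrier (free_alg UNIV) = UNIV"
  by (simp add: free_alg_def)

lemma
  shows qplane_closed: "pclass UNIV (qplane_rels q) p \<in> carrier (Aq q)"
    and qplane_mult: "pclass UNIV (qplane_rels q) p \<otimes>\<^bsub>Aq q\<^esub> pclass UNIV (qplane_rels q) r
      = pclass UNIV (qplane_rels q) (p * r)"
    and qplane_add: "pclass UNIV (qplane_rels q) p \<oplus>\<^bsub>Aq q\<^esub> pclass UNIV (qplane_rels q) r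
      = pclass UNIV (qplane_rels q) (p + r)"
    and qplane_one: "\<one>\<^bsub>Aq q\<^esub> = pclass UNIV (qplane_rels q) 1"
  by (simp_all add: Aq_def free_alg_UNIV pclass_closed pclass_mult pclass_add pclass_one)

lemma scal_closed [simp, intro]: "scal q c \<in> carrier (Aq q)"
  and xgen_closed [simp, intro]: "xgen q \<in> carrier (Aq q)"
  and ygen_closed [simp, intro]: "ygen q \<in> carrier (Aq q)"
  by (simp_all add: scal_def xgen_def ygen_def qplane_closed)

lemma qmon_closed [simp, intro]: "qmon q p \<in> carrier (Aq q)"
  by (simp add: qmon_def)

lemma scal_mult: "scal q (c * d) = scal q c \<otimes>\<^bsub>Aq q\<^esub> scal q d"
  by (simp add: scal_def qplane_mult mult_single plus_fword_def)

lemma scal_add: "scal q (c + d) = scal q c \<oplus>\<^bsub>Aq q\<^esub> scal q d"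
  by (simp add: scal_def qplane_add single_add)

lemma scal_1: "scal q 1 = \<one>\<^bsub>Aq q\<^esub>"
  by (simp add: scal_def qplane_one flip: zero_fword_def)

lemma scal_0: "scal q 0 = \<zero>\<^bsub>Aq q\<^esub>"
  using scal_add[of q 0 0] by simp

lemma scal_minus: "scal q (- c) = \<ominus>\<^bsub>Aq q\<^esub> scal q c"
  using scal_add[of q "- c" c] by (intro Aq.minus_equality[symmetric]) (simp_all add: scal_0)

lemma carrier_Aq: "a \<in> carrier (Aq q) \<longleftrightarrow> (\<exists>p. a = pclass UNIV (qplane_rels q) p)"
  by (auto simp: Aq_def presented_def pclass_def FactRing_def A_RCOSETS_def' free_alg_UNIV)

text \<open>A scalar is the class of a multiple of the empty word. That word is the neutral key of
  the convolution, so the multiple commutes with everything already in the free algebra.\<close>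

lemma scal_central:
  assumes "a \<in> carrier (Aq q)"
  shows "scal q c \<otimes>\<^bsub>Aq q\<^esub> a = a \<otimes>\<^bsub>Aq q\<^esub> scal q c"
proof -
  obtain p where p: "a = pclass UNIV (qplane_rels q) p"
    using assms carrier_Aq by blast
  have "fmon [] c * p = p * fmon [] c"
  proof (induction p rule: update_induct)
    case (update p k v)
    \<comment> \<open>The key \<open>k\<close> is new, so setting its coefficient amounts to adding
      one monomial, which reduces the claim to single words.\<close>
    have "Poly_Mapping.update k v p = p + Poly_Mapping.single k v"
      using update(1)
      by (intro poly_mapping_eqI) (auto simp: lookup_update lookup_add lookup_single in_keys_iff when_def)
    with update(3) show ?case
      by (simp add: distrib_left distrib_right mult_single mult.commute flip: zero_fword_def)
  qed simp
  then show ?thesis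
    by (simp add: p scal_def qplane_mult)
qed

text \<open>The defining relation read in the quotient. In \<open>scal q q\<close> the first
  \<open>q\<close> is the parameter of the algebra, the second the scalar.\<close>

lemma xgen_ygen: "xgen q \<otimes>\<^bsub>Aq q\<^esub> ygen q = scal q q \<otimes>\<^bsub>Aq q\<^esub> (ygen q \<otimes>\<^bsub>Aq q\<^esub> xgen q)"
proof -
  have "pclass UNIV (qplane_rels q) (fmon [GenX, GenY] 1) = pclass UNIV (qplane_rels q) (fmon [GenY, GenX] q)"
    by (rule pclass_eqI) (simp_all add: qplane_rels_def free_alg_UNIV)
  then show ?thesis
    by (simp add: xgen_def ygen_def scal_def mult_single plus_fword_def qplane_mult)
qed

section \<open>Polynomials in an element acting on a module\<close>

text \<open>Horner evaluation of \<open>P(D) w\<close>; it does not mention the carrier of \<open>M\<close>, so it is literally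
  the same function on all submodules.\<close>

definition poly_act :: "complex \<Rightarrow> (qplane, 'b) module \<Rightarrow> qplane \<Rightarrow> complex poly \<Rightarrow> 'b \<Rightarrow> 'b"
  where "poly_act q M D P w =
    fold_coeffs (\<lambda>c v. scal q c \<odot>\<^bsub>M\<^esub> w \<oplus>\<^bsub>M\<^esub> D \<odot>\<^bsub>M\<^esub> v) P \<zero>\<^bsub>M\<^esub>"

text \<open>Algebraic form of finite dimensionality of the orbit of \<open>w\<close> under
  polynomials in \<open>D\<close>; the equivalence is behind \<open>locally_finite_iff\<close>. It
  passes to submodules and to images of homomorphisms at once.\<close>

definition poly_torsion :: "complex \<Rightarrow> (qplane, 'b) module \<Rightarrow> qplane \<Rightarrow> 'b \<Rightarrow> bool"
  where "poly_torsion q M D w \<longleftrightarrow> (\<exists>P. P \<noteq> 0 \<and> poly_act q M D P w = \<zero>\<^bsub>M\<^esub>)"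

definition injective_on_module :: "(qplane, 'b) module \<Rightarrow> qplane \<Rightarrow> bool"
  where "injective_on_module M D \<longleftrightarrow> (\<forall>v\<in>carrier M. D \<odot>\<^bsub>M\<^esub> v = \<zero>\<^bsub>M\<^esub> \<longrightarrow> v = \<zero>\<^bsub>M\<^esub>)"

locale qplane_module = left_module "Aq q" M for q and M :: "(qplane, 'b) module" (structure)
begin

declare smult_closed [simp, intro]

lemma smult_zero [simp]: "a \<in> carrier (Aq q) \<Longrightarrow> a \<odot>\<^bsub>M\<^esub> \<zero>\<^bsub>M\<^esub> = \<zero>\<^bsub>M\<^esub>"
  using smult_r_distr[of a "\<zero>\<^bsub>M\<^esub>" "\<zero>\<^bsub>M\<^esub>"] by simp

lemma scal_0_smult [simp]: "v \<in> carrier M \<Longrightarrow> scal q 0 \<odot>\<^bsub>M\<^esub> v = \<zero>\<^bsub>M\<^esub>"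
  using smult_l_distr[of "scal q 0" "scal q 0" v] by (simp flip: scal_add)

lemma scal_1_smult [simp]: "v \<in> carrier M \<Longrightarrow> scal q 1 \<odot>\<^bsub>M\<^esub> v = v"
  by (simp add: scal_1 smult_one)

lemma scal_scal_smult [simp]:
  "v \<in> carrier M \<Longrightarrow> scal q c \<odot>\<^bsub>M\<^esub> (scal q d \<odot>\<^bsub>M\<^esub> v) = scal q (c * d) \<odot>\<^bsub>M\<^esub> v"
  by (simp add: scal_mult smult_assoc)

lemma smult_scal_commute:
  "a \<in> carrier (Aq q) \<Longrightarrow> v \<in> carrier M \<Longrightarrow>
    a \<odot>\<^bsub>M\<^esub> (scal q c \<odot>\<^bsub>M\<^esub> v) = scal q c \<odot>\<^bsub>M\<^esub> (a \<odot>\<^bsub>M\<^esub> v)"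
  by (simp add: scal_central flip: smult_assoc)

lemma scal_add_smult:
  "v \<in> carrier M \<Longrightarrow> scal q (c + d) \<odot>\<^bsub>M\<^esub> v = scal q c \<odot>\<^bsub>M\<^esub> v \<oplus>\<^bsub>M\<^esub> scal q d \<odot>\<^bsub>M\<^esub> v"
  by (simp add: scal_add smult_l_distr)

lemma scal_minus_1_smult: "v \<in> carrier M \<Longrightarrow> scal q (- 1) \<odot>\<^bsub>M\<^esub> v = \<ominus>\<^bsub>M\<^esub> v"
  using scal_add_smult[of v "- 1" 1] by (intro M.minus_equality[symmetric]) simp_all

lemma scal_smult_eq_zero:
  assumes "v \<in> carrier M" "c \<noteq> 0" "scal q c \<odot>\<^bsub>M\<^esub> v = \<zero>\<^bsub>M\<^esub>"
  shows "v = \<zero>\<^bsub>M\<^esub>"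
proof -
  have "scal q (inverse c) \<odot>\<^bsub>M\<^esub> (scal q c \<odot>\<^bsub>M\<^esub> v) = v"
    using assms(1,2) by (simp del: scal_scal_smult add: scal_scal_smult[OF assms(1)])
  with assms(3) show ?thesis by simp
qed

context
  fixes D assumes D [simp, intro]: "D \<in> carrier (Aq q)"
begin

lemma poly_act_0 [simp]: "poly_act q M D 0 w = \<zero>\<^bsub>M\<^esub>"
  by (simp add: poly_act_def)

lemma poly_act_pCons [simp]:
  assumes "w \<in> carrier M"
  shows "poly_act q M D (pCons c P) w = scal q c \<odot>\<^bsub>M\<^esub> w \<oplus>\<^bsub>M\<^esub> D \<odot>\<^bsub>M\<^esub> poly_act q M D P w"
\<comment> \<open>The exceptional case: \<open>pCons 0 0\<close> is the zero polynomial, for which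
  \<open>fold_coeffs\<close> makes no step. Both sides are then zero.\<close>
proof (cases "c = 0 \<and> P = 0")
  case False
  then show ?thesis by (auto simp: poly_act_def)
qed (use assms in \<open>simp add: poly_act_def\<close>)

lemma poly_act_closed [simp, intro]: "w \<in> carrier M \<Longrightarrow> poly_act q M D P w \<in> carrier M"
  by (induction P) auto

lemma poly_act_smult:
  "w \<in> carrier M \<Longrightarrow> poly_act q M D (Polynomial.smult c P) w = scal q c \<odot>\<^bsub>M\<^esub> poly_act q M D P w"
  by (induction P) (simp_all add: smult_r_distr smult_scal_commute[OF D] mult.commute)

lemma poly_act_add:
  assumes w: "w \<in> carrier M"
  shows "poly_act q M D (P + Q) w = poly_act q M D P w \<oplus>\<^bsub>M\<^esub> poly_act q M D Q w"
proof (induction P arbitrary: Q)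
  case (pCons a P)
  obtain b R where Q: "Q = pCons b R" by (cases Q)
  show ?case
    by (simp add: Q w pCons.IH scal_add_smult smult_r_distr M.a_ac)
qed (simp add: w)

lemma poly_act_diff_eq_0:
  assumes w: "w \<in> carrier M" and "poly_act q M D P w = \<zero>\<^bsub>M\<^esub>" "poly_act q M D Q w = \<zero>\<^bsub>M\<^esub>"
  shows "poly_act q M D (P - Q) w = \<zero>\<^bsub>M\<^esub>"
proof -
  have "P - Q = P + Polynomial.smult (- 1) Q" by simp
  then show ?thesis using assms by (simp only: poly_act_add poly_act_smult) simp
qed

lemma poly_act_mult:
  assumes w: "w \<in> carrier M"
  shows "poly_act q M D (P * Q) w = poly_act q M D P (poly_act q M D Q w)"
  by (induction P) (simp_all add: w poly_act_add poly_act_smult)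

lemma poly_act_right_zero [simp]: "poly_act q M D P \<zero>\<^bsub>M\<^esub> = \<zero>\<^bsub>M\<^esub>"
  by (induction P) auto

lemma poly_act_right_add:
  assumes "v \<in> carrier M" "w \<in> carrier M"
  shows "poly_act q M D P (v \<oplus>\<^bsub>M\<^esub> w) = poly_act q M D P v \<oplus>\<^bsub>M\<^esub> poly_act q M D P w"
  by (induction P) (use assms in \<open>simp_all add: smult_r_distr M.a_ac\<close>)

lemma poly_act_in:
  assumes "w \<in> H" "H \<subseteq> carrier M" "\<zero>\<^bsub>M\<^esub> \<in> H"
    and "\<And>u v. u \<in> H \<Longrightarrow> v \<in> H \<Longrightarrow> u \<oplus>\<^bsub>M\<^esub> v \<in> H"
    and "\<And>a v. a \<in> carrier (Aq q) \<Longrightarrow> v \<in> H \<Longrightarrow> a \<odot>\<^bsub>M\<^esub> v \<in> H"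
  shows "poly_act q M D P w \<in> H"
proof -
  have w: "w \<in> carrier M" using assms by blast
  show ?thesis by (induction P) (use w assms in auto)
qed

lemma poly_torsion_zero [simp, intro]: "poly_torsion q M D \<zero>\<^bsub>M\<^esub>"
  by (auto simp: poly_torsion_def intro: exI[of _ 1])

text \<open>The product of the two annihilating polynomials kills both vectors, because polynomials
  in the same \<open>D\<close> commute.\<close>

lemma poly_torsion_add:
  assumes "v \<in> carrier M" "w \<in> carrier M" "poly_torsion q M D v" "poly_torsion q M D w"
  shows "poly_torsion q M D (v \<oplus>\<^bsub>M\<^esub> w)"
proof -
  obtain P Q where "P \<noteq> 0" "Q \<noteq> 0" "poly_act q M D P v = \<zero>\<^bsub>M\<^esub>" "poly_act q M D Q w = \<zero>\<^bsub>M\<^esub>"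
    using assms(3,4) by (auto simp: poly_torsion_def)
  then have "Q * P \<noteq> 0" "poly_act q M D (Q * P) (v \<oplus>\<^bsub>M\<^esub> w) = \<zero>\<^bsub>M\<^esub>"
    using assms(1,2) poly_act_mult[of v Q P] poly_act_mult[of w P Q]
    by (simp_all add: poly_act_right_add mult.commute[of Q P])
  then show ?thesis unfolding poly_torsion_def by blast
qed

text \<open>Over the complex numbers linear factors can be split off the annihilator one at a time
  until the vector that remains is nonzero. Recording the eigenvector as \<open>Q(D) w\<close> keeps
  it in every submodule that contains \<open>w\<close>.\<close>

lemma eigenvector_of_poly_torsion:
  assumes w: "w \<in> carrier M" "w \<noteq> \<zero>\<^bsub>M\<^esub>" and P: "P \<noteq> 0" "poly_act q M D P w = \<zero>\<^bsub>M\<^esub>"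
  shows "\<exists>Q c. poly_act q M D Q w \<noteq> \<zero>\<^bsub>M\<^esub> \<and>
    D \<odot>\<^bsub>M\<^esub> poly_act q M D Q w = scal q c \<odot>\<^bsub>M\<^esub> poly_act q M D Q w"
  using P
proof (induction "Polynomial.degree P" arbitrary: P)
  case 0
  then obtain c where c: "P = [:c:]" by (metis degree_eq_zeroE)
  then have "scal q c \<odot>\<^bsub>M\<^esub> w = \<zero>\<^bsub>M\<^esub>" using 0 w by simp
  moreover have "c \<noteq> 0" using 0 c by simp
  \<comment> \<open>A nonzero constant acts invertibly and cannot annihilate \<open>w\<close>, so
    the base case is contradictory.\<close>
  ultimately show ?case using scal_smult_eq_zero[OF w(1), of c] w(2) by blast
next
  case (Suc n)
  have "\<not> constant (poly P)" using Suc.hyps(2) by (simp add: constant_degree)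
  then obtain c where "poly P c = 0" using fundamental_theorem_of_algebra by blast
  then obtain Q where Q: "P = [:- c, 1:] * Q" by (auto simp: poly_eq_0_iff_dvd elim: dvdE)
  let ?u = "poly_act q M D Q w"
  have "Q \<noteq> 0" using Suc.prems(1) Q by auto
  then have deg: "Polynomial.degree Q = n" using Suc.hyps(2) Q by (simp add: degree_mult_eq del: mult_pCons_left)
  have u: "?u \<in> carrier M" using w by simp
  have "poly_act q M D [:- c, 1:] ?u = \<zero>\<^bsub>M\<^esub>"
    using Suc.prems(2) poly_act_mult[OF w(1), of "[:- c, 1:]" Q] by (simp only: Q)
  then have "scal q (- c) \<odot>\<^bsub>M\<^esub> ?u \<oplus>\<^bsub>M\<^esub> D \<odot>\<^bsub>M\<^esub> ?u = \<zero>\<^bsub>M\<^esub>" using u by simp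
  moreover have "scal q (- c) \<odot>\<^bsub>M\<^esub> ?u \<oplus>\<^bsub>M\<^esub> scal q c \<odot>\<^bsub>M\<^esub> ?u = \<zero>\<^bsub>M\<^esub>"
    using u by (simp flip: scal_add_smult)
  ultimately have "scal q (- c) \<odot>\<^bsub>M\<^esub> ?u \<oplus>\<^bsub>M\<^esub> D \<odot>\<^bsub>M\<^esub> ?u
      = scal q (- c) \<odot>\<^bsub>M\<^esub> ?u \<oplus>\<^bsub>M\<^esub> scal q c \<odot>\<^bsub>M\<^esub> ?u" by (rule trans[OF _ sym])
  then have "D \<odot>\<^bsub>M\<^esub> ?u = scal q c \<odot>\<^bsub>M\<^esub> ?u"
    by (rule M.add.l_cancel) (use u in auto)
  \<comment> \<open>If \<open>?u\<close> is nonzero it is the eigenvector; otherwise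
    \<open>Q\<close> is an annihilator of smaller degree and the induction hypothesis
    applies.\<close>
  then show ?case
    using Suc.hyps(1)[OF deg[symmetric] \<open>Q \<noteq> 0\<close>] by blast
qed

end

lemma poly_act_monom:
  assumes D: "D \<in> carrier (Aq q)" and w: "w \<in> carrier M"
  shows "poly_act q M D (Polynomial.monom c k) w = (scal q c \<otimes>\<^bsub>Aq q\<^esub> D [^]\<^bsub>Aq q\<^esub> k) \<odot>\<^bsub>M\<^esub> w"
proof (induction k)
  case (Suc k)
  have "D \<otimes>\<^bsub>Aq q\<^esub> (scal q c \<otimes>\<^bsub>Aq q\<^esub> D [^]\<^bsub>Aq q\<^esub> k) = (scal q c \<otimes>\<^bsub>Aq q\<^esub> D) \<otimes>\<^bsub>Aq q\<^esub> D [^]\<^bsub>Aq q\<^esub> k"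
    using D by (simp add: scal_central[OF D] flip: Aq.m_assoc)
  also have "\<dots> = scal q c \<otimes>\<^bsub>Aq q\<^esub> D [^]\<^bsub>Aq q\<^esub> Suc k"
    using D Aq.nat_pow_Suc2[OF D, of k] by (simp add: Aq.m_assoc)
  finally show ?case
    using Suc D w by (simp add: monom_Suc smult_assoc[symmetric] del: Aq.nat_pow_Suc)
qed (use D w in \<open>simp add: monom_0\<close>)

lemma poly_act_pcompose:
  assumes D: "D \<in> carrier (Aq q)" and w: "w \<in> carrier M"
  shows "poly_act q M (scal q c \<otimes>\<^bsub>Aq q\<^esub> D [^]\<^bsub>Aq q\<^esub> (k::nat)) P w
    = poly_act q M D (pcompose P (Polynomial.monom c k)) w"
  by (induction P) (use assms in \<open>simp_all add: pcompose_pCons poly_act_add poly_act_mult poly_act_monom\<close>)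

text \<open>If \<open>P\<close> evaluated at \<open>c D^k\<close> kills \<open>w\<close>, then so
  does \<open>P(c X^k)\<close> evaluated at \<open>D\<close>. As \<open>c X^k\<close> is not
  constant, this composite is again nonzero.\<close>

lemma poly_torsion_of_power:
  assumes D: "D \<in> carrier (Aq q)" and w: "w \<in> carrier M" and "c \<noteq> 0" "(k::nat) > 0"
    and "poly_torsion q M (scal q c \<otimes>\<^bsub>Aq q\<^esub> D [^]\<^bsub>Aq q\<^esub> k) w"
  shows "poly_torsion q M D w"
proof -
  obtain P where "P \<noteq> 0" "poly_act q M (scal q c \<otimes>\<^bsub>Aq q\<^esub> D [^]\<^bsub>Aq q\<^esub> k) P w = \<zero>\<^bsub>M\<^esub>"
    using assms(5) by (auto simp: poly_torsion_def)
  moreover from this have "pcompose P (Polynomial.monom c k) \<noteq> 0"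
    using assms(3,4) by (simp add: pcompose_eq_0_iff degree_monom_eq)
  ultimately show ?thesis
    using poly_act_pcompose[OF D w] by (auto simp: poly_torsion_def)
qed

section \<open>Eigenvectors of quasi-commuting elements\<close>

lemma smult_poly_act_eigenvector:
  assumes D: "D \<in> carrier (Aq q)" "D' \<in> carrier (Aq q)"
    and comm: "D \<otimes>\<^bsub>Aq q\<^esub> D' = scal q c \<otimes>\<^bsub>Aq q\<^esub> (D' \<otimes>\<^bsub>Aq q\<^esub> D)"
    and u: "u \<in> carrier M" "D \<odot>\<^bsub>M\<^esub> u = scal q l \<odot>\<^bsub>M\<^esub> u"
  shows "D \<odot>\<^bsub>M\<^esub> poly_act q M D' P u = scal q l \<odot>\<^bsub>M\<^esub> poly_act q M D' (pcompose P [:0, c:]) u"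
proof (induction P)
  case (pCons a P)
  let ?v = "poly_act q M D' P u" and ?v' = "poly_act q M D' (pcompose P [:0, c:]) u"
  have v: "?v \<in> carrier M" "?v' \<in> carrier M" using D u by auto
  \<comment> \<open>Moving \<open>D\<close> past one factor \<open>D'\<close> costs a factor
    \<open>c\<close>. So \<open>D\<close> turns \<open>P(D') u\<close> into \<open>l\<close> times
    \<open>P(c D') u\<close>, and composition with \<open>[:0, c:]\<close> records the
    rescaling.\<close>
  have "D \<odot>\<^bsub>M\<^esub> (D' \<odot>\<^bsub>M\<^esub> ?v) = (D \<otimes>\<^bsub>Aq q\<^esub> D') \<odot>\<^bsub>M\<^esub> ?v" using D v by (simp add: smult_assoc)
  also have "\<dots> = scal q c \<odot>\<^bsub>M\<^esub> (D' \<odot>\<^bsub>M\<^esub> (D \<odot>\<^bsub>M\<^esub> ?v))"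
    using D v by (simp add: comm smult_assoc)
  also have "\<dots> = scal q l \<odot>\<^bsub>M\<^esub> (D' \<odot>\<^bsub>M\<^esub> (scal q c \<odot>\<^bsub>M\<^esub> ?v'))"
    using D v by (simp add: pCons.IH smult_scal_commute[OF D(2)] mult.commute)
  finally show ?case
    using D u v by (simp add: pcompose_pCons poly_act_add poly_act_smult smult_r_distr
        smult_scal_commute[OF D(1)] mult.commute)
qed (use D u in simp)

text \<open>The independence of eigenvectors with distinct eigenvalues, in polynomial form. If
  \<open>P(D') u = 0\<close>, applying \<open>D\<close> gives \<open>P(c D') u = 0\<close>. The
  difference \<open>P(c X) - P(X)\<close> has no constant term; cancelling \<open>D'\<close> yields
  an annihilator of smaller degree, which must vanish by induction. Hence
  \<open>P(c X) = P(X)\<close>, and genericity makes \<open>P\<close> constant.\<close>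

lemma not_poly_torsion_eigenvector:
  assumes D: "D \<in> carrier (Aq q)" "D' \<in> carrier (Aq q)"
    and inj: "injective_on_module M D" "injective_on_module M D'"
    and comm: "D \<otimes>\<^bsub>Aq q\<^esub> D' = scal q c \<otimes>\<^bsub>Aq q\<^esub> (D' \<otimes>\<^bsub>Aq q\<^esub> D)"
    and c: "generic c"
    and u: "u \<in> carrier M" "u \<noteq> \<zero>\<^bsub>M\<^esub>" "D \<odot>\<^bsub>M\<^esub> u = scal q l \<odot>\<^bsub>M\<^esub> u"
  shows "\<not> poly_torsion q M D' u"
proof -
  \<comment> \<open>For \<open>l = 0\<close> the vector \<open>u\<close> would lie in the kernel of
    \<open>D\<close>.\<close>
  have "l \<noteq> 0" using u inj(1) by (auto simp: injective_on_module_def)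
  have "P = 0" if "poly_act q M D' P u = \<zero>\<^bsub>M\<^esub>" for P
    using that
  proof (induction "Polynomial.degree P" arbitrary: P rule: less_induct)
    case less
    obtain a R where P: "P = pCons a R" by (cases P)
    let ?P' = "pcompose P [:0, c:]"
    \<comment> \<open>Injectivity of \<open>D'\<close> cancels the factor \<open>X\<close>, and the
      induction hypothesis excludes a nonzero quotient \<open>S\<close>.\<close>
    have *: "S = 0" if "poly_act q M D' (pCons 0 S) u = \<zero>\<^bsub>M\<^esub>" "S \<noteq> 0 \<longrightarrow> Polynomial.degree S < Polynomial.degree P" for S
      using that less.hyps[of S] inj(2) D u by (auto simp: injective_on_module_def)
    have "scal q l \<odot>\<^bsub>M\<^esub> poly_act q M D' ?P' u = \<zero>\<^bsub>M\<^esub>"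
      using smult_poly_act_eigenvector[OF D comm u(1,3), of P] less.prems D by simp
    then have "poly_act q M D' ?P' u = \<zero>\<^bsub>M\<^esub>"
      using scal_smult_eq_zero[OF _ \<open>l \<noteq> 0\<close>] D u by auto
    then have "poly_act q M D' (?P' - P) u = \<zero>\<^bsub>M\<^esub>"
      using poly_act_diff_eq_0 less.prems D u by blast
    moreover have P'P: "?P' - P = pCons 0 (Polynomial.smult c (pcompose R [:0, c:]) - R)"
      by (simp add: P pcompose_pCons)
    moreover have "Polynomial.degree (Polynomial.smult c (pcompose R [:0, c:]) - R) < Polynomial.degree P" if "R \<noteq> 0"
    proof -
      have "Polynomial.degree (Polynomial.smult c (pcompose R [:0, c:])) \<le> Polynomial.degree R"
        using degree_smult_le[of c "pcompose R [:0, c:]"] degree_pcompose_le[of R "[:0, c:]"]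
        by (auto split: if_splits)
      then have "Polynomial.degree (Polynomial.smult c (pcompose R [:0, c:]) - R) \<le> Polynomial.degree R"
        by (intro degree_diff_le) auto
      then show ?thesis using that by (simp add: P)
    qed
    ultimately have "Polynomial.smult c (pcompose R [:0, c:]) - R = 0"
      using *[of "Polynomial.smult c (pcompose R [:0, c:]) - R"] by (cases "R = 0") simp_all
    then have "?P' = P" using P'P by simp
    \<comment> \<open>Composition with \<open>c X\<close> multiplies the leading coefficient by
      \<open>c\<close> to the power of the degree.\<close>
    then have "poly.coeff ?P' (Polynomial.degree P) = poly.coeff P (Polynomial.degree P)" by simp
    then have "c ^ Polynomial.degree P = 1 \<or> P = 0"
      by (auto simp: coeff_pcompose_linear)
    then have "Polynomial.degree P = 0" using c by (auto simp: generic_def)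
    then have "P = [:a:]" using P by (auto split: if_splits)
    then show ?case using less.prems u D scal_smult_eq_zero[of u a] by auto
  qed
  then show ?thesis by (auto simp: poly_torsion_def)
qed

text \<open>A nonzero \<open>w\<close> would yield a \<open>D\<close>-eigenvector of the form
  \<open>Q(D) w\<close>, which cannot be \<open>D'\<close>-torsion. This is why
  \<open>D'\<close>-torsion is demanded of all \<open>Q(D) w\<close> and not of \<open>w\<close>
  alone.\<close>

lemma eq_zero_if_poly_torsion_twice:
  assumes D: "D \<in> carrier (Aq q)" "D' \<in> carrier (Aq q)"
    and inj: "injective_on_module M D" "injective_on_module M D'"
    and comm: "D \<otimes>\<^bsub>Aq q\<^esub> D' = scal q c \<otimes>\<^bsub>Aq q\<^esub> (D' \<otimes>\<^bsub>Aq q\<^esub> D)"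
    and c: "generic c"
    and w: "w \<in> carrier M" "poly_torsion q M D w" "\<And>Q. poly_torsion q M D' (poly_act q M D Q w)"
  shows "w = \<zero>\<^bsub>M\<^esub>"
proof (rule ccontr)
  assume "w \<noteq> \<zero>\<^bsub>M\<^esub>"
  then obtain Q l where "poly_act q M D Q w \<noteq> \<zero>\<^bsub>M\<^esub>"
      "D \<odot>\<^bsub>M\<^esub> poly_act q M D Q w = scal q l \<odot>\<^bsub>M\<^esub> poly_act q M D Q w"
    using eigenvector_of_poly_torsion[OF D(1) w(1)] w(2) unfolding poly_torsion_def by blast
  then show False
    using not_poly_torsion_eigenvector[OF D inj comm c] D w by blast
qed

end

section \<open>Commutation of monomials\<close>

lemma Aq_scal_left:
  "a \<in> carrier (Aq q) \<Longrightarrow> b \<in> carrier (Aq q) \<Longrightarrow>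
    a \<otimes>\<^bsub>Aq q\<^esub> (scal q c \<otimes>\<^bsub>Aq q\<^esub> b) = scal q c \<otimes>\<^bsub>Aq q\<^esub> (a \<otimes>\<^bsub>Aq q\<^esub> b)"
  by (simp add: scal_central[of a] flip: Aq.m_assoc)

lemma scal_mult_left:
  "a \<in> carrier (Aq q) \<Longrightarrow>
    scal q c \<otimes>\<^bsub>Aq q\<^esub> (scal q d \<otimes>\<^bsub>Aq q\<^esub> a) = scal q (c * d) \<otimes>\<^bsub>Aq q\<^esub> a"
  by (simp add: scal_mult Aq.m_assoc)

lemma scal_one_left: "a \<in> carrier (Aq q) \<Longrightarrow> scal q 1 \<otimes>\<^bsub>Aq q\<^esub> a = a"
  by (simp add: scal_1)

lemma quasi_commute_pow_right:
  assumes "u \<in> carrier (Aq q)" "v \<in> carrier (Aq q)"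
    and "u \<otimes>\<^bsub>Aq q\<^esub> v = scal q c \<otimes>\<^bsub>Aq q\<^esub> (v \<otimes>\<^bsub>Aq q\<^esub> u)"
  shows "u \<otimes>\<^bsub>Aq q\<^esub> v [^]\<^bsub>Aq q\<^esub> (n::nat) = scal q (c ^ n) \<otimes>\<^bsub>Aq q\<^esub> (v [^]\<^bsub>Aq q\<^esub> n \<otimes>\<^bsub>Aq q\<^esub> u)"
proof (induction n)
  case (Suc n)
  let ?V = "v [^]\<^bsub>Aq q\<^esub> n"
  have "u \<otimes>\<^bsub>Aq q\<^esub> v [^]\<^bsub>Aq q\<^esub> Suc n = scal q (c ^ n) \<otimes>\<^bsub>Aq q\<^esub> (?V \<otimes>\<^bsub>Aq q\<^esub> (u \<otimes>\<^bsub>Aq q\<^esub> v))"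
    using assms(1,2) Suc by (simp add: Aq.m_assoc flip: Aq.m_assoc[of u])
  also have "\<dots> = scal q (c ^ Suc n) \<otimes>\<^bsub>Aq q\<^esub> (v [^]\<^bsub>Aq q\<^esub> Suc n \<otimes>\<^bsub>Aq q\<^esub> u)"
    using assms by (simp add: Aq_scal_left[of ?V] scal_mult_left Aq.m_assoc mult.commute)
  finally show ?case .
qed (use assms in \<open>simp add: scal_1\<close>)

text \<open>Each of the \<open>m\<close> factors \<open>u\<close> passes each of the
  \<open>n\<close> factors \<open>v\<close>, at the cost of one \<open>c\<close>.\<close>

lemma quasi_commute_pow:
  assumes "u \<in> carrier (Aq q)" "v \<in> carrier (Aq q)"
    and "u \<otimes>\<^bsub>Aq q\<^esub> v = scal q c \<otimes>\<^bsub>Aq q\<^esub> (v \<otimes>\<^bsub>Aq q\<^esub> u)"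
  shows "u [^]\<^bsub>Aq q\<^esub> (m::nat) \<otimes>\<^bsub>Aq q\<^esub> v [^]\<^bsub>Aq q\<^esub> (n::nat)
    = scal q (c ^ (m * n)) \<otimes>\<^bsub>Aq q\<^esub> (v [^]\<^bsub>Aq q\<^esub> n \<otimes>\<^bsub>Aq q\<^esub> u [^]\<^bsub>Aq q\<^esub> m)"
proof (induction m)
  case (Suc m)
  let ?U = "u [^]\<^bsub>Aq q\<^esub> m" and ?V = "v [^]\<^bsub>Aq q\<^esub> n"
  have "u [^]\<^bsub>Aq q\<^esub> Suc m \<otimes>\<^bsub>Aq q\<^esub> ?V = scal q (c ^ n) \<otimes>\<^bsub>Aq q\<^esub> ((?U \<otimes>\<^bsub>Aq q\<^esub> ?V) \<otimes>\<^bsub>Aq q\<^esub> u)"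
    using assms(1,2) quasi_commute_pow_right[OF assms, of n]
    by (simp add: Aq.m_assoc Aq_scal_left[of ?U])
  also have "\<dots> = scal q (c ^ (Suc m * n)) \<otimes>\<^bsub>Aq q\<^esub> (?V \<otimes>\<^bsub>Aq q\<^esub> u [^]\<^bsub>Aq q\<^esub> Suc m)"
    using assms(1,2) Suc
    by (simp add: Aq.m_assoc scal_mult_left power_add)
  finally show ?case .
qed (use assms in \<open>simp add: scal_1\<close>)

text \<open>Bringing the inner \<open>y^(snd p) x^(fst r)\<close> into normal order absorbs exactly
  this power of \<open>q\<close>. It stands on the side of the product so that no inverse of
  \<open>q\<close> occurs.\<close>

lemma qmon_mult:
  "scal q (q ^ (fst r * snd p)) \<otimes>\<^bsub>Aq q\<^esub> (qmon q p \<otimes>\<^bsub>Aq q\<^esub> qmon q r) = qmon q (fst p + fst r, snd p + snd r)"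
proof -
  let ?X = "xgen q [^]\<^bsub>Aq q\<^esub> fst p" and ?Y = "ygen q [^]\<^bsub>Aq q\<^esub> snd p"
    and ?X' = "xgen q [^]\<^bsub>Aq q\<^esub> fst r" and ?Y' = "ygen q [^]\<^bsub>Aq q\<^esub> snd r"
  have "scal q (q ^ (fst r * snd p)) \<otimes>\<^bsub>Aq q\<^esub> (qmon q p \<otimes>\<^bsub>Aq q\<^esub> qmon q r)
      = ?X \<otimes>\<^bsub>Aq q\<^esub> ((scal q (q ^ (fst r * snd p)) \<otimes>\<^bsub>Aq q\<^esub> (?Y \<otimes>\<^bsub>Aq q\<^esub> ?X')) \<otimes>\<^bsub>Aq q\<^esub> ?Y')"
    by (simp add: qmon_def Aq.m_assoc Aq_scal_left[of ?X])
  also have "\<dots> = ?X \<otimes>\<^bsub>Aq q\<^esub> ((?X' \<otimes>\<^bsub>Aq q\<^esub> ?Y) \<otimes>\<^bsub>Aq q\<^esub> ?Y')"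
    by (subst quasi_commute_pow[OF _ _ xgen_ygen]) simp_all
  also have "\<dots> = qmon q (fst p + fst r, snd p + snd r)"
    by (simp add: qmon_def Aq.m_assoc flip: Aq.nat_pow_mult)
  finally show ?thesis .
qed

text \<open>By \<open>qmon_mult\<close> in both orders, each product is up to a power of
  \<open>q\<close> the monomial with exponent \<open>p + r\<close>. The scalar is \<open>q\<close>
  to the determinant of \<open>p\<close> and \<open>r\<close>, written as a quotient because
  exponents are natural numbers.\<close>

lemma qmon_quasi_commute:
  assumes "q \<noteq> 0"
  shows "qmon q p \<otimes>\<^bsub>Aq q\<^esub> qmon q r
    = scal q (q ^ (fst p * snd r) / q ^ (fst r * snd p)) \<otimes>\<^bsub>Aq q\<^esub> (qmon q r \<otimes>\<^bsub>Aq q\<^esub> qmon q p)"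
proof -
  have "scal q (q ^ (fst r * snd p)) \<otimes>\<^bsub>Aq q\<^esub> (qmon q p \<otimes>\<^bsub>Aq q\<^esub> qmon q r)
      = scal q (q ^ (fst p * snd r)) \<otimes>\<^bsub>Aq q\<^esub> (qmon q r \<otimes>\<^bsub>Aq q\<^esub> qmon q p)"
    using qmon_mult[of q r p] qmon_mult[of q p r] by (simp add: add.commute)
  then have "scal q (inverse (q ^ (fst r * snd p)))
        \<otimes>\<^bsub>Aq q\<^esub> (scal q (q ^ (fst r * snd p)) \<otimes>\<^bsub>Aq q\<^esub> (qmon q p \<otimes>\<^bsub>Aq q\<^esub> qmon q r))
      = scal q (inverse (q ^ (fst r * snd p)))
        \<otimes>\<^bsub>Aq q\<^esub> (scal q (q ^ (fst p * snd r)) \<otimes>\<^bsub>Aq q\<^esub> (qmon q r \<otimes>\<^bsub>Aq q\<^esub> qmon q p))"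
    by simp
  then show ?thesis
    using assms by (simp add: scal_mult_left scal_one_left divide_inverse mult.commute)
qed

lemma qmon_pow:
  assumes "q \<noteq> 0"
  shows "\<exists>c. c \<noteq> 0 \<and> qmon q (k * a, k * b) = scal q c \<otimes>\<^bsub>Aq q\<^esub> qmon q (a, b) [^]\<^bsub>Aq q\<^esub> k"
proof (induction k)
  case 0
  have "qmon q (0, 0) = scal q 1 \<otimes>\<^bsub>Aq q\<^esub> qmon q (a, b) [^]\<^bsub>Aq q\<^esub> (0::nat)"
    by (simp add: qmon_def scal_1)
  then show ?case by (intro exI[of _ 1]) simp
next
  case (Suc k)
  then obtain c where c: "c \<noteq> 0" "qmon q (k * a, k * b) = scal q c \<otimes>\<^bsub>Aq q\<^esub> qmon q (a, b) [^]\<^bsub>Aq q\<^esub> k"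
    by blast
  \<comment> \<open>The new power of \<open>q\<close> comes from moving \<open>x^a\<close> past
    \<open>y^(k b)\<close>.\<close>
  have "qmon q (Suc k * a, Suc k * b) = scal q (q ^ (a * (k * b))) \<otimes>\<^bsub>Aq q\<^esub> (qmon q (k * a, k * b) \<otimes>\<^bsub>Aq q\<^esub> qmon q (a, b))"
    using qmon_mult[of q "(a, b)" "(k * a, k * b)"] by (simp add: add.commute)
  also have "\<dots> = scal q (q ^ (a * (k * b)) * c) \<otimes>\<^bsub>Aq q\<^esub> qmon q (a, b) [^]\<^bsub>Aq q\<^esub> Suc k"
    by (simp add: c(2) Aq.m_assoc scal_mult_left)
  finally show ?case using c(1) assms by (intro exI[of _ "q ^ (a * (k * b)) * c"]) simp
qed

text \<open>A vanishing determinant makes the pairs proportional; coprimality on both sides turns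
  this into mutual divisibility of the entries.\<close>

lemma primitive_pairs_eqI:
  assumes "p \<in> primitive_pairs" "r \<in> primitive_pairs" "fst p * snd r = fst r * snd p"
  shows "p = r"
proof -
  obtain a b c d where p: "p = (a, b)" "r = (c, d)" by fastforce
  have co: "coprime a b" "coprime c d"
    using assms(1,2) by (auto simp: p primitive_pairs_def coprime_iff_gcd_eq_1)
  have eq: "a * d = c * b" using assms(3) p by simp
  have "a dvd c" "b dvd d" "c dvd a" "d dvd b"
    using eq co
    by (metis coprime_dvd_mult_left_iff coprime_dvd_mult_right_iff coprime_commute dvd_triv_left dvd_triv_right)+
  then show ?thesis using p by (simp add: dvd_antisym)
qed

text \<open>Distinct primitive pairs have nonzero determinant. A power of the scalar equal to one
  would therefore identify two powers of \<open>q\<close> with different exponents.\<close>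

lemma generic_quasi_commute:
  assumes q: "q \<noteq> 0" "generic q" and "p \<in> primitive_pairs" "r \<in> primitive_pairs" "p \<noteq> r"
  shows "generic (q ^ (fst p * snd r) / q ^ (fst r * snd p))"
proof -
  have inj: "i = j" if "q ^ i = q ^ j" for i j :: nat
  proof (rule ccontr)
    assume "i \<noteq> j"
    then have "q ^ (max i j - min i j) = 1"
      using that q(1) by (simp add: power_diff max_def min_def)
    then show False
      using q(2) \<open>i \<noteq> j\<close> by (auto simp: generic_def max_def min_def split: if_splits)
  qed
  show ?thesis unfolding generic_def
  proof (intro allI impI notI)
    fix n :: nat assume n: "n > 0" and "(q ^ (fst p * snd r) / q ^ (fst r * snd p)) ^ n = 1"
    then have "q ^ (fst p * snd r * n) = q ^ (fst r * snd p * n)"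
      using q(1) by (simp add: power_divide flip: power_mult)
    then have "fst p * snd r * n = fst r * snd p * n" by (rule inj)
    then show False using primitive_pairs_eqI[OF assms(3,4)] assms(5) n by simp
  qed
qed

text \<open>Division by the gcd, which serves as \<open>k\<close>. This replaces the arbitrary
  exponents in the definition of admissibility by primitive ones.\<close>

lemma primitive_multiple:
  assumes "d \<noteq> (0, 0)"
  shows "\<exists>p\<in>primitive_pairs. \<exists>k>0. d = (k * fst p, k * snd p)"
proof -
  obtain m n where d: "d = (m, n)" by fastforce
  let ?g = "gcd m n"
  have g: "?g > 0" using assms d by simp
  have "coprime (m div ?g) (n div ?g)" using assms d by (intro div_gcd_coprime) simp
  then have "(m div ?g, n div ?g) \<in> primitive_pairs"
    by (auto simp: primitive_pairs_def)
  moreover have "d = (?g * (m div ?g), ?g * (n div ?g))" by (simp add: d)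
  ultimately show ?thesis using g by (metis fst_conv snd_conv)
qed

section \<open>Tensor products\<close>

lemma tensor_rels_subset:
  assumes "ring B" "\<phi> \<in> carrier R \<rightarrow> carrier B" "left_module R M"
  shows "tensor_rels R B \<phi> M \<subseteq> carrier (free_Abelian_group (carrier B \<times> carrier M))"
proof -
  interpret B: ring B by fact
  interpret left_module R M by fact
  let ?C = "carrier (free_Abelian_group (carrier B \<times> carrier M))"
  have diff: "x - y \<in> ?C" if "x \<in> ?C" "y \<in> ?C" for x y
    using that keys_diff[of x y] by auto
  have "\<phi> a \<in> carrier B" if "a \<in> carrier R" for a using assms(2) that by auto
  then show ?thesis
    unfolding tensor_rels_def
    by (auto intro!: diff smult_closed simp del: carrier_free_Abelian_group_iff)
qed

lemma tensor_subgroup_subgroup: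
  assumes "ring B" "\<phi> \<in> carrier R \<rightarrow> carrier B" "left_module R M"
  shows "subgroup (tensor_subgroup R B \<phi> M) (free_Abelian_group (carrier B \<times> carrier M))"
  unfolding tensor_subgroup_def
  by (intro group.generate_is_subgroup group_free_Abelian_group tensor_rels_subset assms)

text \<open>Pure tensors are cosets, so their equality becomes membership of a formal difference in
  the subgroup of relations. Functoriality and the invertibility of \<open>K\<close> are both
  exploited in this form.\<close>

lemma pure_tensor_eq_iff:
  assumes "ring B" "\<phi> \<in> carrier R \<rightarrow> carrier B" "left_module R M"
    and "b \<in> carrier B" "v \<in> carrier M" "w \<in> carrier M"
  shows "pure_tensor R B \<phi> M b v = pure_tensor R B \<phi> M b w \<longleftrightarrow>
    frag_of (b, v) - frag_of (b, w) \<in> tensor_subgroup R B \<phi> M"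
proof -
  let ?F = "free_Abelian_group (carrier B \<times> carrier M)" and ?T = "tensor_subgroup R B \<phi> M"
  interpret T: subgroup ?T ?F by (rule tensor_subgroup_subgroup[OF assms(1-3)])
  have add: "x + y \<in> ?T" if "x \<in> ?T" "y \<in> ?T" for x y
    using T.m_closed[OF that] by simp
  have minus: "- x \<in> ?T" if "x \<in> ?T" for x
    using T.m_inv_closed[OF that] T.mem_carrier[OF that] by simp
  have coset: "x \<in> ?T #>\<^bsub>?F\<^esub> y \<longleftrightarrow> x - y \<in> ?T" for x y
    by (auto simp: r_coset_def intro: bexI[of _ "x - y"])
  show ?thesis
  proof
    assume "pure_tensor R B \<phi> M b v = pure_tensor R B \<phi> M b w"
    moreover have "frag_of (b, v) \<in> pure_tensor R B \<phi> M b v"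
      unfolding pure_tensor_def coset using T.one_closed by simp
    ultimately have "frag_of (b, v) \<in> pure_tensor R B \<phi> M b w" by (simp only:)
    then show "frag_of (b, v) - frag_of (b, w) \<in> ?T"
      by (simp only: pure_tensor_def coset)
  next
    assume *: "frag_of (b, v) - frag_of (b, w) \<in> ?T"
    have "x - frag_of (b, v) \<in> ?T \<longleftrightarrow> x - frag_of (b, w) \<in> ?T" for x
      using add[OF _ *, of "x - frag_of (b, v)"] add[OF _ minus[OF *], of "x - frag_of (b, w)"] by auto
    then show "pure_tensor R B \<phi> M b v = pure_tensor R B \<phi> M b w"
      unfolding pure_tensor_def set_eq_iff coset by blast
  qed
qed

text \<open>Functoriality of the tensor product on representatives: as \<open>f\<close> is additive
  and linear, \<open>1 (x) f\<close> sends each of the three kinds of relation to one of the same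
  kind.\<close>

lemma tensor_subgroup_hom:
  assumes "ring B" "\<phi> \<in> carrier R \<rightarrow> carrier B" "left_module R M" "left_module R M'"
    and f: "f \<in> left_module_hom R M M'"
    and "x \<in> tensor_subgroup R B \<phi> M"
  shows "frag_extend (\<lambda>(b, v). frag_of (b, f v)) x \<in> tensor_subgroup R B \<phi> M'"
proof -
  let ?e = "frag_extend (\<lambda>(b, v). frag_of (b, f v))"
  interpret M: left_module R M by fact
  interpret M': left_module R M' by fact
  interpret T': subgroup "tensor_subgroup R B \<phi> M'" "free_Abelian_group (carrier B \<times> carrier M')"
    by (rule tensor_subgroup_subgroup[OF assms(1,2,4)])
  have rel: "?e h \<in> tensor_rels R B \<phi> M'" if "h \<in> tensor_rels R B \<phi> M" for h
    using that f unfolding tensor_rels_def left_module_hom_def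
    by (elim UnE; clarsimp simp: frag_extend_diff M.smult_closed) blast+
  then have rel': "?e h \<in> tensor_subgroup R B \<phi> M'" if "h \<in> tensor_rels R B \<phi> M" for h
    unfolding tensor_subgroup_def using that by (intro generate.incl)
  show ?thesis
    using assms(6) unfolding tensor_subgroup_def[of R B \<phi> M]
  proof (induction rule: generate.induct)
    case one
    show ?case using T'.one_closed by simp
  next
    case (incl h)
    then show ?case by (rule rel')
  next
    case (inv h)
    have "h \<in> carrier (free_Abelian_group (carrier B \<times> carrier M))"
      using tensor_rels_subset[OF assms(1-3)] inv by blast
    then show ?case
      using T'.m_inv_closed[OF rel'[OF inv]] T'.mem_carrier[OF rel'[OF inv]]
      by (simp add: frag_extend_minus)
  next
    case (eng h1 h2)
    then show ?case using T'.m_closed[of "?e h1" "?e h2"] by (simp add: frag_extend_add)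
  qed
qed

section \<open>The map \<open>kappa\<close> into the localised module\<close>

lemma Kpowers_subset: "Kpowers q \<subseteq> carrier (Aq q)"
  by (auto simp: Kpowers_def)

lemma ring_Aq_loc: "ring (Aq_loc q)"
  by (rule ring_localisation[OF ring_Aq Kpowers_subset])

lemma loc_map_Aq_closed: "loc_map (Aq q) (Kpowers q) \<in> carrier (Aq q) \<rightarrow> carrier (Aq_loc q)"
  using loc_map_closed[OF ring_Aq Kpowers_subset] by auto

lemma kappa_eq_iff:
  assumes "left_module (Aq q) M" "v \<in> carrier M" "w \<in> carrier M"
  shows "kappa q M v = kappa q M w \<longleftrightarrow> frag_of (\<one>\<^bsub>Aq_loc q\<^esub>, v) - frag_of (\<one>\<^bsub>Aq_loc q\<^esub>, w)
    \<in> tensor_subgroup (Aq q) (Aq_loc q) (loc_map (Aq q) (Kpowers q)) M"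
  unfolding kappa_def
  by (rule pure_tensor_eq_iff[OF ring_Aq_loc loc_map_Aq_closed assms(1) _ assms(2,3)])
    (rule ring.ring_simprules(6)[OF ring_Aq_loc])

text \<open>Naturality of \<open>kappa\<close>. It is applied to inclusions of submodules and to the
  projections of a direct sum.\<close>

lemma kappa_hom:
  assumes M: "left_module (Aq q) M" "left_module (Aq q) M'" and f: "f \<in> left_module_hom (Aq q) M M'"
    and "v \<in> carrier M" "w \<in> carrier M" "kappa q M v = kappa q M w"
  shows "kappa q M' (f v) = kappa q M' (f w)"
proof -
  have "f v \<in> carrier M'" "f w \<in> carrier M'"
    using assms by (auto simp: left_module_hom_def)
  then show ?thesis
    using assms tensor_subgroup_hom[OF ring_Aq_loc loc_map_Aq_closed M f,
        of "frag_of (\<one>\<^bsub>Aq_loc q\<^esub>, v) - frag_of (\<one>\<^bsub>Aq_loc q\<^esub>, w)"]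
    by (simp add: kappa_eq_iff frag_extend_diff)
qed

lemma injective_on_module_if_kappa_inj:
  assumes M: "left_module (Aq q) M" and inj: "inj_on (kappa q M) (carrier M)"
  shows "injective_on_module M (qmon q (1, 1))"
  unfolding injective_on_module_def
proof (intro ballI impI)
  fix v assume v: "v \<in> carrier M" "qmon q (1, 1) \<odot>\<^bsub>M\<^esub> v = \<zero>\<^bsub>M\<^esub>"
  interpret left_module "Aq q" M by (rule M)
  interpret B: ring "Aq_loc q" by (rule ring_Aq_loc)
  let ?\<phi> = "loc_map (Aq q) (Kpowers q)"
  let ?T = "tensor_subgroup (Aq q) (Aq_loc q) ?\<phi> M" and ?rels = "tensor_rels (Aq q) (Aq_loc q) ?\<phi> M"
  interpret T: subgroup ?T "free_Abelian_group (carrier (Aq_loc q) \<times> carrier M)"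
    by (rule tensor_subgroup_subgroup[OF ring_Aq_loc loc_map_Aq_closed M])
  have rels: "x \<in> ?T" if "x \<in> ?rels" for x
    unfolding tensor_subgroup_def using that by (rule generate.incl)
  have add: "x + y \<in> ?T" if "x \<in> ?T" "y \<in> ?T" for x y
    using T.m_closed[OF that] by simp
  have minus: "- x \<in> ?T" if "x \<in> ?T" for x
    using T.m_inv_closed[OF that] T.mem_carrier[OF that] by simp
  have "qmon q (1, 1) \<in> Kpowers q"
    by (auto simp: Kpowers_def intro!: exI[of _ "1::nat"])
  from loc_map_left_inverse[OF ring_Aq Kpowers_subset this] obtain b
    where b: "b \<in> carrier (Aq_loc q)" "b \<otimes>\<^bsub>Aq_loc q\<^esub> ?\<phi> (qmon q (1, 1)) = \<one>\<^bsub>Aq_loc q\<^esub>" by blast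
  \<comment> \<open>The relation for \<open>c (x) (0 + 0)\<close> collapses to the negative of
    \<open>c (x) 0\<close>.\<close>
  have zero: "frag_of (c, \<zero>\<^bsub>M\<^esub>) \<in> ?T" if "c \<in> carrier (Aq_loc q)" for c
  proof -
    have "frag_of (c, \<zero>\<^bsub>M\<^esub> \<oplus>\<^bsub>M\<^esub> \<zero>\<^bsub>M\<^esub>) - frag_of (c, \<zero>\<^bsub>M\<^esub>) - frag_of (c, \<zero>\<^bsub>M\<^esub>) \<in> ?rels"
      unfolding tensor_rels_def using that by blast
    from minus[OF rels[OF this]] show ?thesis by simp
  qed
  \<comment> \<open>As \<open>b K = 1\<close>, this balancing relation says
    \<open>1 (x) v = b (x) K v = b (x) 0\<close>.\<close>
  have "frag_of (b \<otimes>\<^bsub>Aq_loc q\<^esub> ?\<phi> (qmon q (1, 1)), v) - frag_of (b, qmon q (1, 1) \<odot>\<^bsub>M\<^esub> v) \<in> ?rels"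
    unfolding tensor_rels_def using b(1) v(1) qmon_closed by blast
  from rels[OF this] have "frag_of (\<one>\<^bsub>Aq_loc q\<^esub>, v) - frag_of (b, \<zero>\<^bsub>M\<^esub>) \<in> ?T"
    by (simp only: b(2) v(2))
  \<comment> \<open>Adding \<open>b (x) 0\<close> and subtracting \<open>1 (x) 0\<close>, both of
    them relations, leaves the difference that \<open>kappa_eq_iff\<close> asks for.\<close>
  from add[OF add[OF this zero[OF b(1)]] minus[OF zero[OF B.one_closed]]]
  have "kappa q M v = kappa q M \<zero>\<^bsub>M\<^esub>"
    by (simp add: kappa_eq_iff[OF M v(1)])
  then show "v = \<zero>\<^bsub>M\<^esub>" using inj v(1) by (auto dest: inj_onD)
qed

section \<open>Local finiteness\<close>

definition scal_span :: "complex \<Rightarrow> (qplane, 'b) module \<Rightarrow> 'b set \<Rightarrow> 'b set"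
  where "scal_span q M B = {finsum M (\<lambda>b. scal q (c b) \<odot>\<^bsub>M\<^esub> b) B | c. True}"

lemma (in abelian_monoid) finsum_in:
  assumes "H \<subseteq> carrier G" "\<zero> \<in> H" "\<And>u v. u \<in> H \<Longrightarrow> v \<in> H \<Longrightarrow> u \<oplus> v \<in> H"
    and "\<And>i. i \<in> A \<Longrightarrow> f i \<in> H"
  shows "finsum G f A \<in> H"
proof (cases "finite A")
  case True
  then show ?thesis using assms(4)
  proof (induction A rule: finite_induct)
    case (insert i A)
    then have "finsum G f (insert i A) = f i \<oplus> finsum G f A"
      using assms(1) by (intro finsum_insert) auto
    with insert assms(3) show ?case by simp
  qed (use assms(2) in simp)
qed (use assms(2) in simp)

context qplane_module
begin

lemma scal_span_closed:
  assumes "finite B" "B \<subseteq> carrier M"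
  shows "b \<in> B \<Longrightarrow> b \<in> scal_span q M B"
    and "u \<in> scal_span q M B \<Longrightarrow> v \<in> scal_span q M B \<Longrightarrow> u \<oplus>\<^bsub>M\<^esub> v \<in> scal_span q M B"
    and "v \<in> scal_span q M B \<Longrightarrow> scal q a \<odot>\<^bsub>M\<^esub> v \<in> scal_span q M B"
    and "\<zero>\<^bsub>M\<^esub> \<in> scal_span q M B"
proof -
  have car: "(\<lambda>b. scal q (c b) \<odot>\<^bsub>M\<^esub> b) \<in> B \<rightarrow> carrier M" for c
    using assms(2) by auto
  {
    assume b: "b \<in> B"
    have "finsum M (\<lambda>x. scal q (if b = x then 1 else 0) \<odot>\<^bsub>M\<^esub> x) B
        = finsum M (\<lambda>x. if b = x then x else \<zero>\<^bsub>M\<^esub>) B"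
      using assms(2) by (intro M.finsum_cong') auto
    also have "\<dots> = b" using b assms by (intro M.finsum_singleton) auto
    finally show "b \<in> scal_span q M B" unfolding scal_span_def mem_Collect_eq
      by (intro exI[of _ "\<lambda>x. if b = x then 1 else 0"]) simp
  next
    assume "u \<in> scal_span q M B" "v \<in> scal_span q M B"
    then obtain c d where "u = finsum M (\<lambda>b. scal q (c b) \<odot>\<^bsub>M\<^esub> b) B"
      "v = finsum M (\<lambda>b. scal q (d b) \<odot>\<^bsub>M\<^esub> b) B" by (auto simp: scal_span_def)
    then have "u \<oplus>\<^bsub>M\<^esub> v = finsum M (\<lambda>b. scal q (c b) \<odot>\<^bsub>M\<^esub> b \<oplus>\<^bsub>M\<^esub> scal q (d b) \<odot>\<^bsub>M\<^esub> b) B"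
      using M.finsum_addf[OF car car] by simp
    also have "\<dots> = finsum M (\<lambda>b. scal q (c b + d b) \<odot>\<^bsub>M\<^esub> b) B"
      using assms(2) by (intro M.finsum_cong') (auto simp: scal_add_smult)
    finally show "u \<oplus>\<^bsub>M\<^esub> v \<in> scal_span q M B" by (auto simp: scal_span_def)
  next
    assume "v \<in> scal_span q M B"
    then obtain c where v: "v = finsum M (\<lambda>b. scal q (c b) \<odot>\<^bsub>M\<^esub> b) B" by (auto simp: scal_span_def)
    have "scal q a \<odot>\<^bsub>M\<^esub> finsum M (\<lambda>b. scal q (c b) \<odot>\<^bsub>M\<^esub> b) A
        = finsum M (\<lambda>b. scal q (a * c b) \<odot>\<^bsub>M\<^esub> b) A" if "finite A" "A \<subseteq> carrier M" for A
      using that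
    proof (induction A rule: finite_induct)
      case (insert x A)
      then have "(\<lambda>b. scal q (d b) \<odot>\<^bsub>M\<^esub> b) \<in> A \<rightarrow> carrier M" for d by auto
      with insert show ?case by (simp add: smult_r_distr)
    qed simp
    from this[OF assms] show "scal q a \<odot>\<^bsub>M\<^esub> v \<in> scal_span q M B" by (auto simp: scal_span_def v)
  next
    have "finsum M (\<lambda>x. scal q 0 \<odot>\<^bsub>M\<^esub> x) B = finsum M (\<lambda>x. \<zero>\<^bsub>M\<^esub>) B"
      using assms(2) by (intro M.finsum_cong') auto
    then have "finsum M (\<lambda>x. scal q 0 \<odot>\<^bsub>M\<^esub> x) B = \<zero>\<^bsub>M\<^esub>" by simp
    then show "\<zero>\<^bsub>M\<^esub> \<in> scal_span q M B" unfolding scal_span_def mem_Collect_eq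
      by (intro exI[of _ "\<lambda>_. 0"]) simp
  }
qed

text \<open>By induction over its generation, every element of the subring acts as a polynomial in
  \<open>D\<close>; conversely, Horner's scheme builds each polynomial from \<open>D\<close> and
  scalars inside the subring.\<close>

lemma poly_subalgebra_orbit:
  assumes D: "D \<in> carrier (Aq q)" and w: "w \<in> carrier M"
  shows "(\<lambda>a. a \<odot>\<^bsub>M\<^esub> w) ` poly_subalgebra q D = range (\<lambda>P. poly_act q M D P w)"
proof
  have car: "insert D (range (scal q)) \<subseteq> carrier (Aq q)" using D by auto
  \<comment> \<open>The polynomial is chosen uniformly in \<open>w\<close>: in the product case
    \<open>h1\<close> acts on \<open>h2 w\<close> and not on \<open>w\<close>.\<close>
  have "\<exists>P. \<forall>w\<in>carrier M. a \<odot>\<^bsub>M\<^esub> w = poly_act q M D P w" if "a \<in> poly_subalgebra q D" for a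
    using that unfolding poly_subalgebra_def
  proof (induction rule: generate_ring.induct)
    case one
    show ?case using D by (intro exI[of _ "[:1:]"]) (simp add: smult_one)
  next
    case (incl h)
    then consider "h = D" | c where "h = scal q c" by blast
    then show ?case
    proof cases
      case 1
      show ?thesis using D by (intro exI[of _ "[:0, 1:]"]) (simp add: 1)
    next
      case 2
      show ?thesis using D by (intro exI[of _ "[:c:]"]) (simp add: 2)
    qed
  next
    case (a_inv h)
    then have h: "h \<in> carrier (Aq q)" using Aq.generate_ring_in_carrier[OF car] by blast
    from a_inv obtain P where P: "\<forall>w\<in>carrier M. h \<odot>\<^bsub>M\<^esub> w = poly_act q M D P w" by blast
    have "\<ominus>\<^bsub>Aq q\<^esub> h \<odot>\<^bsub>M\<^esub> w = scal q (- 1) \<odot>\<^bsub>M\<^esub> (h \<odot>\<^bsub>M\<^esub> w)" if "w \<in> carrier M" for w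
      using h that by (simp add: scal_minus scal_1 Aq.l_minus flip: smult_assoc)
    then show ?case
      using P D by (intro exI[of _ "Polynomial.smult (- 1) P"]) (simp add: poly_act_smult del: smult_minus_left)
  next
    case (eng_add h1 h2)
    then have h: "h1 \<in> carrier (Aq q)" "h2 \<in> carrier (Aq q)"
      using Aq.generate_ring_in_carrier[OF car] by blast+
    from eng_add obtain P Q where "\<forall>w\<in>carrier M. h1 \<odot>\<^bsub>M\<^esub> w = poly_act q M D P w"
      "\<forall>w\<in>carrier M. h2 \<odot>\<^bsub>M\<^esub> w = poly_act q M D Q w" by blast
    then show ?case
      using h D by (intro exI[of _ "P + Q"]) (simp add: poly_act_add smult_l_distr)
  next
    case (eng_mult h1 h2)
    then have h: "h1 \<in> carrier (Aq q)" "h2 \<in> carrier (Aq q)"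
      using Aq.generate_ring_in_carrier[OF car] by blast+
    from eng_mult obtain P Q where "\<forall>w\<in>carrier M. h1 \<odot>\<^bsub>M\<^esub> w = poly_act q M D P w"
      "\<forall>w\<in>carrier M. h2 \<odot>\<^bsub>M\<^esub> w = poly_act q M D Q w" by blast
    then show ?case
      using h D by (intro exI[of _ "P * Q"]) (simp add: poly_act_mult smult_assoc)
  qed
  then show "(\<lambda>a. a \<odot>\<^bsub>M\<^esub> w) ` poly_subalgebra q D \<subseteq> range (\<lambda>P. poly_act q M D P w)"
    using w by blast
  have scal: "scal q c \<in> poly_subalgebra q D" and D': "D \<in> poly_subalgebra q D" for c
    unfolding poly_subalgebra_def by (auto intro: generate_ring.incl)
  have "\<exists>a\<in>poly_subalgebra q D. a \<in> carrier (Aq q) \<and> poly_act q M D P w = a \<odot>\<^bsub>M\<^esub> w" for P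
  proof (induction P)
    case 0
    show ?case using scal D w by (intro bexI[of _ "scal q 0"]) auto
  next
    case (pCons c P)
    then obtain a where a: "a \<in> poly_subalgebra q D" "a \<in> carrier (Aq q)" "poly_act q M D P w = a \<odot>\<^bsub>M\<^esub> w"
      by blast
    have "scal q c \<oplus>\<^bsub>Aq q\<^esub> D \<otimes>\<^bsub>Aq q\<^esub> a \<in> poly_subalgebra q D"
      using a(1) scal[of c] D' unfolding poly_subalgebra_def
      by (intro generate_ring.eng_add generate_ring.eng_mult)
    then show ?case
      using a D w by (intro bexI[of _ "scal q c \<oplus>\<^bsub>Aq q\<^esub> D \<otimes>\<^bsub>Aq q\<^esub> a"]) (simp_all add: smult_l_distr smult_assoc)
  qed
  then show "range (\<lambda>P. poly_act q M D P w) \<subseteq> (\<lambda>a. a \<odot>\<^bsub>M\<^esub> w) ` poly_subalgebra q D"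
    by blast
qed

text \<open>Let finitely many \<open>Q_b(D) w\<close> span the orbit and let \<open>n\<close> exceed
  all their degrees. Then \<open>D^n w\<close> is a combination of them, and \<open>X^n\<close>
  minus the corresponding combination of the \<open>Q_b\<close> is a nonzero annihilator.\<close>

lemma poly_torsion_if_finite_dim:
  assumes D: "D \<in> carrier (Aq q)" and w: "w \<in> carrier M"
    and fin: "finite_dim q M (range (\<lambda>P. poly_act q M D P w))"
  shows "poly_torsion q M D w"
proof -
  let ?C = "range (\<lambda>P. poly_act q M D P w)"
  obtain B where B: "finite B" "B \<subseteq> ?C" "?C = scal_span q M B"
    using fin by (auto simp: finite_dim_def scal_span_def)
  then have "\<forall>b\<in>B. \<exists>Q. b = poly_act q M D Q w" by blast
  then obtain Q where Q: "\<And>b. b \<in> B \<Longrightarrow> b = poly_act q M D (Q b) w" by metis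
  \<comment> \<open>The sum bounds every single degree, and the successor makes the bound strict, so
    that the coefficient of \<open>X^n\<close> survives.\<close>
  define n where "n = Suc (\<Sum>b\<in>B. Polynomial.degree (Q b))"
  have deg: "Polynomial.degree (Q b) < n" if "b \<in> B" for b
    using member_le_sum[of b B "\<lambda>b. Polynomial.degree (Q b)"] B(1) that by (simp add: n_def)
  have "poly_act q M D (Polynomial.monom 1 n) w \<in> scal_span q M B" using B(3) by blast
  then obtain c where c: "poly_act q M D (Polynomial.monom 1 n) w = finsum M (\<lambda>b. scal q (c b) \<odot>\<^bsub>M\<^esub> b) B"
    by (auto simp: scal_span_def)
  have "finsum M (\<lambda>b. scal q (c b) \<odot>\<^bsub>M\<^esub> b) A = poly_act q M D (\<Sum>b\<in>A. Polynomial.smult (c b) (Q b)) w"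
    if "finite A" "A \<subseteq> B" for A
    using that
  proof (induction A rule: finite_induct)
    case (insert b A)
    have "B \<subseteq> carrier M" using B(2) D w by auto
    then have "(\<lambda>b. scal q (c b) \<odot>\<^bsub>M\<^esub> b) \<in> A \<rightarrow> carrier M" "b \<in> carrier M"
      using insert.prems by auto
    then have "finsum M (\<lambda>b. scal q (c b) \<odot>\<^bsub>M\<^esub> b) (insert b A)
        = scal q (c b) \<odot>\<^bsub>M\<^esub> b \<oplus>\<^bsub>M\<^esub> finsum M (\<lambda>b. scal q (c b) \<odot>\<^bsub>M\<^esub> b) A"
      using insert.hyps by simp
    moreover have "scal q (c b) \<odot>\<^bsub>M\<^esub> b = poly_act q M D (Polynomial.smult (c b) (Q b)) w"
      using Q[of b] insert.prems by (simp add: poly_act_smult[OF D w])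
    ultimately show ?case
      using insert D w by (simp add: poly_act_add)
  qed (use D in simp)
  from this[OF B(1)] c
  have "poly_act q M D (Polynomial.monom 1 n) w = poly_act q M D (\<Sum>b\<in>B. Polynomial.smult (c b) (Q b)) w"
    by simp
  moreover have "poly.coeff (\<Sum>b\<in>B. Polynomial.smult (c b) (Q b)) n = 0"
    using deg by (auto simp: coeff_sum coeff_eq_0 intro!: sum.neutral)
  then have "Polynomial.monom 1 n + Polynomial.smult (- 1) (\<Sum>b\<in>B. Polynomial.smult (c b) (Q b)) \<noteq> 0"
    by (metis add.right_neutral coeff_0 coeff_add coeff_smult coeff_monom mult_zero_right zero_neq_one)
  moreover have "scal q (- 1) \<odot>\<^bsub>M\<^esub> v = \<ominus>\<^bsub>M\<^esub> v" if "v \<in> carrier M" for v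
    using that by (rule scal_minus_1_smult)
  ultimately show ?thesis
    unfolding poly_torsion_def using D w
    by (intro exI[of _ "Polynomial.monom 1 n + Polynomial.smult (- 1) (\<Sum>b\<in>B. Polynomial.smult (c b) (Q b))"])
      (simp add: poly_act_add poly_act_smult M.r_neg del: smult_minus_left)
qed

text \<open>Division with remainder by the annihilator \<open>P\<close>: only the remainder acts on
  \<open>w\<close>, so the \<open>D^i w\<close> with \<open>i\<close> below the degree of
  \<open>P\<close> span the orbit.\<close>

lemma finite_dim_if_poly_torsion:
  assumes D: "D \<in> carrier (Aq q)" and w: "w \<in> carrier M" and "poly_torsion q M D w"
  shows "finite_dim q M (range (\<lambda>P. poly_act q M D P w))"
proof -
  obtain P where P: "P \<noteq> 0" "poly_act q M D P w = \<zero>\<^bsub>M\<^esub>"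
    using assms(3) unfolding poly_torsion_def by blast
  define B where "B = (\<lambda>i. poly_act q M D (Polynomial.monom 1 i) w) ` {..<Polynomial.degree P}"
  have B: "finite B" "B \<subseteq> carrier M" "B \<subseteq> range (\<lambda>P. poly_act q M D P w)"
    using D w by (auto simp: B_def)
  \<comment> \<open>The case \<open>R = 0\<close> is listed separately because the zero polynomial
    has degree 0, which is not below the degree of a constant \<open>P\<close>; the family
    \<open>B\<close> is then empty.\<close>
  have span: "poly_act q M D R w \<in> scal_span q M B"
    if R: "R = 0 \<or> Polynomial.degree R < Polynomial.degree P" for R
  proof (cases "R = 0")
    case False
    have "poly_act q M D (\<Sum>i\<in>A. Polynomial.monom (poly.coeff R i) i) w \<in> scal_span q M B"
      if "finite A" "A \<subseteq> {..<Polynomial.degree P}" for A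
      using that
    proof (induction A rule: finite_induct)
      case (insert i A)
      have "poly_act q M D (Polynomial.smult (poly.coeff R i) (Polynomial.monom 1 i)) w \<in> scal_span q M B"
        unfolding poly_act_smult[OF D w] using insert.prems
        by (intro scal_span_closed(3)[OF B(1,2)] scal_span_closed(1)[OF B(1,2)]) (auto simp: B_def)
      then show ?case
        using insert scal_span_closed(2)[OF B(1,2)] by (simp add: poly_act_add[OF D w] smult_monom)
    qed (use D scal_span_closed(4)[OF B(1,2)] in simp)
    moreover have "{..Polynomial.degree R} \<subseteq> {..<Polynomial.degree P}" using R False by auto
    ultimately show ?thesis
      by (metis finite_atMost poly_as_sum_of_monoms)
  qed (use D scal_span_closed(4)[OF B(1,2)] in simp)
  have "poly_act q M D Q w \<in> scal_span q M B" for Q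
  proof -
    have "poly_act q M D (Q div P * P + Q mod P) w = poly_act q M D (Q mod P) w"
      using P(2) by (simp only: poly_act_add[OF D w] poly_act_mult[OF D w])
        (use D w in simp)
    then have "poly_act q M D Q w = poly_act q M D (Q mod P) w" by (simp only: div_mult_mod_eq)
    moreover have "Q mod P = 0 \<or> Polynomial.degree (Q mod P) < Polynomial.degree P"
      by (rule degree_mod_less[OF P(1)])
    ultimately show ?thesis using span by simp
  qed
  moreover have "scal_span q M B \<subseteq> range (\<lambda>P. poly_act q M D P w)"
  proof -
    have "finsum M (\<lambda>b. scal q (c b) \<odot>\<^bsub>M\<^esub> b) B \<in> range (\<lambda>P. poly_act q M D P w)" for c
    proof (rule M.finsum_in)
      show "range (\<lambda>P. poly_act q M D P w) \<subseteq> carrier M" using D w by auto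
      show "\<zero>\<^bsub>M\<^esub> \<in> range (\<lambda>P. poly_act q M D P w)"
        using poly_act_0[OF D, of w] by (metis rangeI)
      show "u \<oplus>\<^bsub>M\<^esub> v \<in> range (\<lambda>P. poly_act q M D P w)"
        if "u \<in> range (\<lambda>P. poly_act q M D P w)" "v \<in> range (\<lambda>P. poly_act q M D P w)" for u v
        using that by (auto simp flip: poly_act_add[OF D w])
      show "scal q (c b) \<odot>\<^bsub>M\<^esub> b \<in> range (\<lambda>P. poly_act q M D P w)" if "b \<in> B" for b
        using that by (auto simp: B_def simp flip: poly_act_smult[OF D w])
    qed
    then show ?thesis by (auto simp: scal_span_def)
  qed
  ultimately have "range (\<lambda>P. poly_act q M D P w) = scal_span q M B" by blast
  then show ?thesis
    unfolding finite_dim_def scal_span_def[symmetric] using B(1,3) by blast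
qed

text \<open>From here on local finiteness enters only as torsion of every vector.\<close>

lemma locally_finite_iff:
  assumes "D \<in> carrier (Aq q)"
  shows "locally_finite q D M \<longleftrightarrow> (\<forall>w\<in>carrier M. poly_torsion q M D w)"
  unfolding locally_finite_def
  using poly_torsion_if_finite_dim[OF assms] finite_dim_if_poly_torsion[OF assms]
    poly_subalgebra_orbit[OF assms] by auto

end

section \<open>Submodules and direct sums\<close>

lemma submoduleD:
  assumes "left_module R M" "submodule H R M"
  shows "H \<subseteq> carrier M" and "\<zero>\<^bsub>M\<^esub> \<in> H"
    and "u \<in> H \<Longrightarrow> v \<in> H \<Longrightarrow> u \<oplus>\<^bsub>M\<^esub> v \<in> H"
    and "a \<in> carrier R \<Longrightarrow> v \<in> H \<Longrightarrow> a \<odot>\<^bsub>M\<^esub> v \<in> H"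
proof -
  interpret H: submodule H R M by fact
  show "H \<subseteq> carrier M" "\<zero>\<^bsub>M\<^esub> \<in> H" using H.subset H.one_closed by simp_all
  show "u \<in> H \<Longrightarrow> v \<in> H \<Longrightarrow> u \<oplus>\<^bsub>M\<^esub> v \<in> H" using H.m_closed by simp
  show "a \<in> carrier R \<Longrightarrow> v \<in> H \<Longrightarrow> a \<odot>\<^bsub>M\<^esub> v \<in> H" by (rule H.smult_closed)
qed

lemma left_module_submodule:
  assumes M: "left_module R M" and H: "submodule H R M"
  shows "left_module R (M\<lparr>carrier := H\<rparr>)"
proof -
  interpret left_module R M by fact
  interpret H: submodule H R M by fact
  note sub = submoduleD[OF M H]
  have "\<exists>y\<in>H. y \<oplus>\<^bsub>M\<^esub> x = \<zero>\<^bsub>M\<^esub>" if "x \<in> H" for x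
  proof
    show "\<ominus>\<^bsub>M\<^esub> x \<in> H" using H.m_inv_closed[OF that] unfolding a_inv_def .
    show "\<ominus>\<^bsub>M\<^esub> x \<oplus>\<^bsub>M\<^esub> x = \<zero>\<^bsub>M\<^esub>" using sub(1) that by (intro M.l_neg) blast
  qed
  then have "abelian_group (M\<lparr>carrier := H\<rparr>)"
    by (intro abelian_groupI) (use sub in \<open>auto simp: M.a_ac subset_iff\<close>)
  then show ?thesis
    by (intro left_module.intro left_module_axioms.intro R.ring_axioms)
      (use sub in \<open>auto simp: smult_l_distr smult_r_distr smult_assoc smult_one subset_iff\<close>)
qed

lemma submodule_carrier:
  assumes "left_module R M"
  shows "submodule (carrier M) R M"
proof -
  interpret left_module R M by fact
  show ?thesis
    by (intro submodule.intro submodule_axioms.intro smult_closed M.add.subgroup_self)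
qed

lemma inclusion_hom:
  assumes "left_module R M" "submodule H R M"
  shows "(\<lambda>v. v) \<in> left_module_hom R (M\<lparr>carrier := H\<rparr>) M"
  using submoduleD(1)[OF assms] by (auto simp: left_module_hom_def)

section \<open>Finite sums and internal direct sums of submodules\<close>

lemma sum_of_closed:
  assumes "left_module R M" "\<And>i. i \<in> I \<Longrightarrow> submodule (N i) R M"
  shows "sum_of M I N \<subseteq> carrier M"
    and "\<zero>\<^bsub>M\<^esub> \<in> sum_of M I N"
    and "u \<in> sum_of M I N \<Longrightarrow> v \<in> sum_of M I N \<Longrightarrow> u \<oplus>\<^bsub>M\<^esub> v \<in> sum_of M I N"
    and "finite I \<Longrightarrow> i \<in> I \<Longrightarrow> v \<in> N i \<Longrightarrow> v \<in> sum_of M I N"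
proof -
  interpret left_module R M by fact
  note sub = submoduleD[OF assms(1) assms(2)]
  have car: "f \<in> I \<rightarrow> carrier M" if "f \<in> Pi I N" for f
    using that sub(1) by blast
  show "sum_of M I N \<subseteq> carrier M" using car by (auto simp: sum_of_def)
  show "\<zero>\<^bsub>M\<^esub> \<in> sum_of M I N"
    unfolding sum_of_def using sub(2) by (auto intro!: exI[of _ "\<lambda>_. \<zero>\<^bsub>M\<^esub>"])
  show "u \<oplus>\<^bsub>M\<^esub> v \<in> sum_of M I N" if "u \<in> sum_of M I N" "v \<in> sum_of M I N"
  proof -
    obtain f g where f: "u = finsum M f I" "f \<in> Pi I N" and g: "v = finsum M g I" "g \<in> Pi I N"
      using \<open>u \<in> sum_of M I N\<close> \<open>v \<in> sum_of M I N\<close> unfolding sum_of_def by blast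
    have "u \<oplus>\<^bsub>M\<^esub> v = finsum M (\<lambda>i. f i \<oplus>\<^bsub>M\<^esub> g i) I"
      using f g car by (simp add: M.finsum_addf)
    moreover have "(\<lambda>i. f i \<oplus>\<^bsub>M\<^esub> g i) \<in> Pi I N" using f(2) g(2) sub(3) by blast
    ultimately show ?thesis unfolding sum_of_def by blast
  qed
  show "v \<in> sum_of M I N" if "finite I" "i \<in> I" "v \<in> N i"
  proof -
    have "v \<in> carrier M" using that sub(1) by blast
    then have fin: "finsum M (\<lambda>j. if i = j then v else \<zero>\<^bsub>M\<^esub>) I = v"
      using M.finsum_singleton[of i I "\<lambda>_. v"] that(1,2) by simp
    have "(\<lambda>j. if i = j then v else \<zero>\<^bsub>M\<^esub>) \<in> Pi I N" using that(3) sub(2) by auto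
    with fin[symmetric] show ?thesis unfolding sum_of_def mem_Collect_eq by (intro exI conjI)
  qed
qed

lemma (in left_module) smult_finsum:
  assumes "finite A" "f \<in> A \<rightarrow> carrier M" and a: "a \<in> carrier R"
  shows "a \<odot>\<^bsub>M\<^esub> finsum M f A = finsum M (\<lambda>i. a \<odot>\<^bsub>M\<^esub> f i) A"
  using assms(1,2)
proof (induction A rule: finite_induct)
  case empty
  have "a \<odot>\<^bsub>M\<^esub> \<zero>\<^bsub>M\<^esub> \<oplus>\<^bsub>M\<^esub> a \<odot>\<^bsub>M\<^esub> \<zero>\<^bsub>M\<^esub> = a \<odot>\<^bsub>M\<^esub> \<zero>\<^bsub>M\<^esub>"
    using smult_r_distr[OF a, of "\<zero>\<^bsub>M\<^esub>" "\<zero>\<^bsub>M\<^esub>"] by simp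
  then show ?case using smult_closed[OF a, of "\<zero>\<^bsub>M\<^esub>"] by simp
next
  case (insert x A)
  then have "(\<lambda>i. a \<odot>\<^bsub>M\<^esub> f i) \<in> A \<rightarrow> carrier M" "f \<in> A \<rightarrow> carrier M" "f x \<in> carrier M"
    using smult_closed[OF a] by auto
  with insert show ?case by (simp add: smult_r_distr[OF a] smult_closed[OF a])
qed

text \<open>Independence is applied to the difference of \<open>f\<close> and \<open>g\<close>.
  Subtraction is expressed through the action of \<open>-1\<close>, so that closure of the
  \<open>N i\<close> under scalars keeps the difference inside them.\<close>

lemma direct_sum_unique:
  assumes sum: "direct_sum R M I N" and f: "f \<in> Pi I N" and g: "g \<in> Pi I N"
    and eq: "finsum M f I = finsum M g I" and "i \<in> I"
  shows "f i = g i"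
proof -
  have M: "left_module R M" and I: "finite I" and N: "\<And>i. i \<in> I \<Longrightarrow> submodule (N i) R M"
    and indep: "\<And>v. v \<in> Pi I N \<Longrightarrow> finsum M v I = \<zero>\<^bsub>M\<^esub> \<Longrightarrow> \<forall>i\<in>I. v i = \<zero>\<^bsub>M\<^esub>"
    using sum by (auto simp: direct_sum_def)
  interpret left_module R M by (rule M)
  note sub = submoduleD[OF M N]
  have car: "h \<in> I \<rightarrow> carrier M" if "h \<in> Pi I N" for h
    using that sub(1) by blast
  let ?a = "\<ominus>\<^bsub>R\<^esub> \<one>\<^bsub>R\<^esub>"
  have neg: "v \<oplus>\<^bsub>M\<^esub> ?a \<odot>\<^bsub>M\<^esub> v = \<zero>\<^bsub>M\<^esub>" if v: "v \<in> carrier M" for v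
  proof -
    have "v \<oplus>\<^bsub>M\<^esub> \<zero>\<^bsub>R\<^esub> \<odot>\<^bsub>M\<^esub> v = (\<one>\<^bsub>R\<^esub> \<oplus>\<^bsub>R\<^esub> \<zero>\<^bsub>R\<^esub>) \<odot>\<^bsub>M\<^esub> v"
      using v by (subst smult_l_distr) (simp_all add: smult_one)
    then have "v \<oplus>\<^bsub>M\<^esub> \<zero>\<^bsub>R\<^esub> \<odot>\<^bsub>M\<^esub> v = v" using v by (simp add: smult_one)
    then have "\<zero>\<^bsub>R\<^esub> \<odot>\<^bsub>M\<^esub> v = \<zero>\<^bsub>M\<^esub>" using v smult_closed[of "\<zero>\<^bsub>R\<^esub>" v] by simp
    then have "(\<one>\<^bsub>R\<^esub> \<oplus>\<^bsub>R\<^esub> ?a) \<odot>\<^bsub>M\<^esub> v = \<zero>\<^bsub>M\<^esub>" by (simp add: R.r_neg)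
    then show ?thesis using v by (simp add: smult_l_distr smult_one)
  qed
  have g': "(\<lambda>i. ?a \<odot>\<^bsub>M\<^esub> g i) \<in> Pi I N"
    using g sub(4)[OF _ R.a_inv_closed[OF R.one_closed]] by blast
  have "finsum M (\<lambda>i. f i \<oplus>\<^bsub>M\<^esub> ?a \<odot>\<^bsub>M\<^esub> g i) I = finsum M f I \<oplus>\<^bsub>M\<^esub> ?a \<odot>\<^bsub>M\<^esub> finsum M g I"
    using M.finsum_addf[OF car[OF f] car[OF g']] smult_finsum[OF I car[OF g], of ?a] by simp
  also have "\<dots> = \<zero>\<^bsub>M\<^esub>" unfolding eq using car[OF g] by (intro neg) simp
  finally have "f i \<oplus>\<^bsub>M\<^esub> ?a \<odot>\<^bsub>M\<^esub> g i = \<zero>\<^bsub>M\<^esub>"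
    using indep[of "\<lambda>i. f i \<oplus>\<^bsub>M\<^esub> ?a \<odot>\<^bsub>M\<^esub> g i"] f g' sub(3) \<open>i \<in> I\<close> by blast
  moreover have fi: "f i \<in> carrier M" "g i \<in> carrier M" using car[OF f] car[OF g] \<open>i \<in> I\<close> by auto
  ultimately have "f i \<oplus>\<^bsub>M\<^esub> ?a \<odot>\<^bsub>M\<^esub> g i = g i \<oplus>\<^bsub>M\<^esub> ?a \<odot>\<^bsub>M\<^esub> g i" using neg by simp
  then show ?thesis using fi smult_closed[of ?a "g i"] by simp
qed

text \<open>The components are merely chosen; their uniqueness then forces the choice to be additive
  and linear.\<close>

lemma direct_sum_projections:
  assumes sum: "direct_sum R M I N"
  obtains s where "\<And>v. v \<in> carrier M \<Longrightarrow> s v \<in> Pi I N \<and> finsum M (s v) I = v"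
    and "\<And>i. i \<in> I \<Longrightarrow> (\<lambda>v. s v i) \<in> left_module_hom R M (M\<lparr>carrier := N i\<rparr>)"
proof -
  have M: "left_module R M" and I: "finite I" and N: "\<And>i. i \<in> I \<Longrightarrow> submodule (N i) R M"
    and car: "carrier M = sum_of M I N"
    using sum by (auto simp: direct_sum_def)
  interpret left_module R M by (rule M)
  note sub = submoduleD[OF M N]
  have "\<forall>v\<in>carrier M. \<exists>f. f \<in> Pi I N \<and> finsum M f I = v"
    unfolding car sum_of_def by blast
  then obtain s where s: "\<And>v. v \<in> carrier M \<Longrightarrow> s v \<in> Pi I N \<and> finsum M (s v) I = v"
    by metis
  then have s': "s v \<in> I \<rightarrow> carrier M" if "v \<in> carrier M" for v
    using that sub(1) by blast
  have "(\<lambda>v. s v i) \<in> left_module_hom R M (M\<lparr>carrier := N i\<rparr>)" if i: "i \<in> I" for i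
    unfolding left_module_hom_def
  proof (intro CollectI conjI ballI)
    show "(\<lambda>v. s v i) \<in> carrier M \<rightarrow> carrier (M\<lparr>carrier := N i\<rparr>)" using s i by auto
    fix v assume v: "v \<in> carrier M"
    show "s (v \<oplus>\<^bsub>M\<^esub> w) i = s v i \<oplus>\<^bsub>M\<lparr>carrier := N i\<rparr>\<^esub> s w i" if w: "w \<in> carrier M" for w
    proof -
      have eq: "finsum M (s (v \<oplus>\<^bsub>M\<^esub> w)) I = finsum M (\<lambda>i. s v i \<oplus>\<^bsub>M\<^esub> s w i) I"
        using v w s[of v] s[of w] s[of "v \<oplus>\<^bsub>M\<^esub> w"] s'[of v] s'[of w] by (simp add: M.finsum_addf)
      have "(\<lambda>i. s v i \<oplus>\<^bsub>M\<^esub> s w i) \<in> Pi I N" using s[OF v] s[OF w] sub(3) by blast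
      from direct_sum_unique[OF sum conjunct1[OF s[OF M.a_closed[OF v w]]] this eq i]
      show ?thesis by simp
    qed
    show "s (a \<odot>\<^bsub>M\<^esub> v) i = a \<odot>\<^bsub>M\<lparr>carrier := N i\<rparr>\<^esub> s v i" if a: "a \<in> carrier R" for a
    proof -
      have eq: "finsum M (s (a \<odot>\<^bsub>M\<^esub> v)) I = finsum M (\<lambda>i. a \<odot>\<^bsub>M\<^esub> s v i) I"
        using smult_finsum[OF I s'[OF v] a] s[OF v] s[OF smult_closed[OF a v]] by simp
      have "(\<lambda>i. a \<odot>\<^bsub>M\<^esub> s v i) \<in> Pi I N" using s[OF v] sub(4)[OF _ a] by blast
      from direct_sum_unique[OF sum conjunct1[OF s[OF smult_closed[OF a v]]] this eq i]
      show ?thesis by simp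
    qed
  qed
  with s show ?thesis by (rule that)
qed

section \<open>Torsion parts\<close>

text \<open>The largest submodule on which the monomial is locally finite. Quantifying over all
  \<open>a\<close> builds closure under the action into the definition.\<close>

definition torsion_part :: "complex \<Rightarrow> (qplane, 'b) module \<Rightarrow> nat \<times> nat \<Rightarrow> 'b set"
  where "torsion_part q M p =
    {w \<in> carrier M. \<forall>a\<in>carrier (Aq q). poly_torsion q M (qmon q p) (a \<odot>\<^bsub>M\<^esub> w)}"

lemma catC_tilde_iff:
  "catC_tilde q p M \<longleftrightarrow> left_module (Aq q) M \<and> (\<forall>w\<in>carrier M. poly_torsion q M (qmon q p) w)"
  using qplane_module.locally_finite_iff[of q M "qmon q p"]
  by (auto simp: catC_tilde_def qplane_module_def)

lemma poly_torsion_restrict [simp]: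
  "poly_torsion q (M\<lparr>carrier := H\<rparr>) D w \<longleftrightarrow> poly_torsion q M D w"
  by (simp add: poly_torsion_def poly_act_def)

lemma poly_act_hom:
  assumes "left_module (Aq q) M" "left_module (Aq q) M'" "f \<in> left_module_hom (Aq q) M M'"
    and D: "D \<in> carrier (Aq q)" and w: "w \<in> carrier M"
  shows "f (poly_act q M D P w) = poly_act q M' D P (f w)"
proof -
  interpret M: qplane_module q M using assms(1) by (simp add: qplane_module_def)
  interpret M': qplane_module q M' using assms(2) by (simp add: qplane_module_def)
  have f: "f v \<in> carrier M'" "v' \<in> carrier M \<Longrightarrow> f (v \<oplus>\<^bsub>M\<^esub> v') = f v \<oplus>\<^bsub>M'\<^esub> f v'"
    "a \<in> carrier (Aq q) \<Longrightarrow> f (a \<odot>\<^bsub>M\<^esub> v) = a \<odot>\<^bsub>M'\<^esub> f v" if "v \<in> carrier M" for v v' a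
    using assms(3) that by (auto simp: left_module_hom_def)
  \<comment> \<open>Zero is read as the scalar 0 times \<open>w\<close>, so that linearity of
    \<open>f\<close> applies.\<close>
  have "f \<zero>\<^bsub>M\<^esub> = scal q 0 \<odot>\<^bsub>M'\<^esub> f w" using f(3)[OF w, of "scal q 0"] w by simp
  then have "f \<zero>\<^bsub>M\<^esub> = \<zero>\<^bsub>M'\<^esub>" using f(1)[OF w] by simp
  then show ?thesis by (induction P) (use D w f in simp_all)
qed

context qplane_module
begin

lemma submodule_torsion_part: "submodule (torsion_part q M p) (Aq q) M"
proof -
  have sub: "torsion_part q M p \<subseteq> carrier M" by (auto simp: torsion_part_def)
  have smult: "a \<odot>\<^bsub>M\<^esub> v \<in> torsion_part q M p" if "a \<in> carrier (Aq q)" "v \<in> torsion_part q M p" for a v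
    using that by (auto simp: torsion_part_def simp flip: smult_assoc)
  have "\<ominus>\<^bsub>M\<^esub> v \<in> torsion_part q M p" if v: "v \<in> torsion_part q M p" for v
    using smult[OF scal_closed[of q "- 1"] v] sub v scal_minus_1_smult[of v] by auto
  then show ?thesis
    using sub smult
    by (intro submodule.intro subgroup.intro submodule_axioms.intro)
      (auto simp: torsion_part_def smult_r_distr a_inv_def intro: poly_torsion_add)
qed

lemma poly_torsion_torsion_part: "w \<in> torsion_part q M p \<Longrightarrow> poly_torsion q M (qmon q p) w"
  using Aq.one_closed smult_one by (force simp: torsion_part_def)

lemma poly_act_torsion_part:
  "D \<in> carrier (Aq q) \<Longrightarrow> w \<in> torsion_part q M p \<Longrightarrow> poly_act q M D P w \<in> torsion_part q M p"
  using submoduleD[OF left_module_axioms submodule_torsion_part[of p]]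
  by (intro poly_act_in)

text \<open>If \<open>y v = 0\<close> then \<open>K v = x y v = 0\<close>; if \<open>x v = 0\<close>
  then \<open>K v = q y x v = 0\<close>. So both generators act injectively, and with them their
  powers and all monomials.\<close>

lemma injective_on_module_qmon:
  assumes q: "q \<noteq> 0" and K: "injective_on_module M (qmon q (1, 1))"
  shows "injective_on_module M (qmon q p)"
proof -
  have K': "v = \<zero>\<^bsub>M\<^esub>" if "v \<in> carrier M" "xgen q \<odot>\<^bsub>M\<^esub> (ygen q \<odot>\<^bsub>M\<^esub> v) = \<zero>\<^bsub>M\<^esub>" for v
    using K that by (simp add: injective_on_module_def qmon_def smult_assoc)
  have y: "v = \<zero>\<^bsub>M\<^esub>" if "v \<in> carrier M" "ygen q \<odot>\<^bsub>M\<^esub> v = \<zero>\<^bsub>M\<^esub>" for v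
    using K'[OF that(1)] that(2) by simp
  have x: "v = \<zero>\<^bsub>M\<^esub>" if "v \<in> carrier M" "xgen q \<odot>\<^bsub>M\<^esub> v = \<zero>\<^bsub>M\<^esub>" for v
  proof (rule K'[OF that(1)])
    have "xgen q \<odot>\<^bsub>M\<^esub> (ygen q \<odot>\<^bsub>M\<^esub> v) = (xgen q \<otimes>\<^bsub>Aq q\<^esub> ygen q) \<odot>\<^bsub>M\<^esub> v"
      using that by (simp add: smult_assoc)
    also have "\<dots> = scal q q \<odot>\<^bsub>M\<^esub> (ygen q \<odot>\<^bsub>M\<^esub> (xgen q \<odot>\<^bsub>M\<^esub> v))"
      unfolding xgen_ygen using that(1) by (simp add: smult_assoc)
    finally show "xgen q \<odot>\<^bsub>M\<^esub> (ygen q \<odot>\<^bsub>M\<^esub> v) = \<zero>\<^bsub>M\<^esub>" using that by simp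
  qed
  have pow: "v = \<zero>\<^bsub>M\<^esub>"
    if "v \<in> carrier M" "u [^]\<^bsub>Aq q\<^esub> n \<odot>\<^bsub>M\<^esub> v = \<zero>\<^bsub>M\<^esub>" "u \<in> carrier (Aq q)"
      "\<And>v. v \<in> carrier M \<Longrightarrow> u \<odot>\<^bsub>M\<^esub> v = \<zero>\<^bsub>M\<^esub> \<Longrightarrow> v = \<zero>\<^bsub>M\<^esub>" for u v and n :: nat
    using that(1,2)
  proof (induction n arbitrary: v)
    case 0
    then show ?case using smult_one[OF 0(1)] by simp
  next
    case (Suc n)
    have "u \<odot>\<^bsub>M\<^esub> v = \<zero>\<^bsub>M\<^esub>"
    proof (rule Suc.IH)
      show "u \<odot>\<^bsub>M\<^esub> v \<in> carrier M" using that(3) Suc.prems(1) by simp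
      show "u [^]\<^bsub>Aq q\<^esub> n \<odot>\<^bsub>M\<^esub> (u \<odot>\<^bsub>M\<^esub> v) = \<zero>\<^bsub>M\<^esub>"
        using smult_assoc[OF Aq.nat_pow_closed[OF that(3), of n] that(3) Suc.prems(1)] Suc.prems(2) by simp
    qed
    with Suc.prems(1) show ?case by (rule that(4))
  qed
  show ?thesis
    unfolding injective_on_module_def
  proof (intro ballI impI)
    fix v assume v: "v \<in> carrier M" "qmon q p \<odot>\<^bsub>M\<^esub> v = \<zero>\<^bsub>M\<^esub>"
    let ?w = "ygen q [^]\<^bsub>Aq q\<^esub> snd p \<odot>\<^bsub>M\<^esub> v"
    have "xgen q [^]\<^bsub>Aq q\<^esub> fst p \<odot>\<^bsub>M\<^esub> ?w = \<zero>\<^bsub>M\<^esub>"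
      using v smult_assoc[of "xgen q [^]\<^bsub>Aq q\<^esub> fst p" "ygen q [^]\<^bsub>Aq q\<^esub> snd p" v]
      by (simp add: qmon_def)
    moreover have "?w \<in> carrier M" using v(1) by simp
    ultimately have "?w = \<zero>\<^bsub>M\<^esub>" using pow[OF _ _ xgen_closed] x by blast
    then show "v = \<zero>\<^bsub>M\<^esub>" using pow[OF v(1) _ ygen_closed] y by blast
  qed
qed

lemma poly_act_finsum:
  assumes "finite A" "f \<in> A \<rightarrow> carrier M" "D \<in> carrier (Aq q)"
  shows "poly_act q M D P (finsum M f A) = finsum M (\<lambda>i. poly_act q M D P (f i)) A"
  using assms(1,2)
proof (induction A rule: finite_induct)
  case (insert x A)
  then have "(\<lambda>i. poly_act q M D P (f i)) \<in> A \<rightarrow> carrier M" "f \<in> A \<rightarrow> carrier M" "f x \<in> carrier M"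
    using assms(3) by auto
  with insert assms(3) show ?case by (simp add: poly_act_right_add)
qed (use assms(3) in simp)

lemma poly_torsion_eq_zero:
  assumes q: "q \<noteq> 0" "generic q" and K: "injective_on_module M (qmon q (1, 1))"
    and p: "p \<in> primitive_pairs" "r \<in> primitive_pairs" "p \<noteq> r"
    and w: "w \<in> carrier M" "poly_torsion q M (qmon q p) w"
    and "\<And>Q. poly_torsion q M (qmon q r) (poly_act q M (qmon q p) Q w)"
  shows "w = \<zero>\<^bsub>M\<^esub>"
  by (rule eq_zero_if_poly_torsion_twice[OF qmon_closed qmon_closed
        injective_on_module_qmon[OF q(1) K] injective_on_module_qmon[OF q(1) K]
        qmon_quasi_commute[OF q(1)] generic_quasi_commute[OF q p] w assms(9)])

text \<open>A polynomial in \<open>D_r\<close> that kills \<open>v r\<close> is applied to the whole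
  sum. The other components stay in their torsion parts, so by induction it kills each of them too.
  Each is then torsion for \<open>D_r\<close> as well as for its own monomial, hence zero, which
  leaves \<open>v r = 0\<close>.\<close>

lemma torsion_parts_independent:
  assumes q: "q \<noteq> 0" "generic q" and K: "injective_on_module M (qmon q (1, 1))"
    and "finite F" "F \<subseteq> primitive_pairs" "v \<in> Pi F (torsion_part q M)" "finsum M v F = \<zero>\<^bsub>M\<^esub>"
  shows "\<forall>p\<in>F. v p = \<zero>\<^bsub>M\<^esub>"
  using assms(4-7)
proof (induction F arbitrary: v rule: finite_induct)
  case (insert r F)
  let ?D = "qmon q r"
  have v: "v p \<in> torsion_part q M p" "v p \<in> carrier M" if "p \<in> insert r F" for p
    using insert.prems(2) that by (auto simp: torsion_part_def)
  then have car: "v \<in> F \<rightarrow> carrier M" by auto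
  then have S: "finsum M v F \<in> carrier M" by simp
  have sum: "v r \<oplus>\<^bsub>M\<^esub> finsum M v F = \<zero>\<^bsub>M\<^esub>"
    using insert.prems(3) insert.hyps car v(2)[of r] by simp
  obtain P where P: "P \<noteq> 0" "poly_act q M ?D P (v r) = \<zero>\<^bsub>M\<^esub>"
    using poly_torsion_torsion_part[OF v(1)[of r]] unfolding poly_torsion_def by blast
  have "poly_act q M ?D P (finsum M v F) = \<zero>\<^bsub>M\<^esub>"
    using poly_act_right_add[OF qmon_closed v(2)[of r] S, of r P] P(2) S sum by simp
  then have "finsum M (\<lambda>p. poly_act q M ?D P (v p)) F = \<zero>\<^bsub>M\<^esub>"
    by (simp add: poly_act_finsum[OF insert.hyps(1) car])
  moreover have "(\<lambda>p. poly_act q M ?D P (v p)) \<in> Pi F (torsion_part q M)"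
    using v(1) by (auto intro: poly_act_torsion_part)
  ultimately have killed: "poly_act q M ?D P (v p) = \<zero>\<^bsub>M\<^esub>" if "p \<in> F" for p
    using insert.IH[of "\<lambda>p. poly_act q M ?D P (v p)"] insert.prems(1) that by blast
  have zero: "v p = \<zero>\<^bsub>M\<^esub>" if p: "p \<in> F" for p
  proof (rule poly_torsion_eq_zero[OF q K])
    show "r \<in> primitive_pairs" "p \<in> primitive_pairs" "r \<noteq> p"
      using p insert.prems(1) insert.hyps by auto
    show "v p \<in> carrier M" "poly_torsion q M ?D (v p)"
      using v(2) p killed P(1) unfolding poly_torsion_def by blast+
    show "poly_torsion q M (qmon q p) (poly_act q M ?D Q (v p))" for Q
      using v(1)[of p] p by (intro poly_torsion_torsion_part poly_act_torsion_part) auto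
  qed
  have "finsum M v F = finsum M (\<lambda>_. \<zero>\<^bsub>M\<^esub>) F"
    using zero by (intro M.finsum_cong') auto
  then have "v r = \<zero>\<^bsub>M\<^esub>" using sum v(2)[of r] by simp
  then show ?case using zero by blast
qed simp

end

section \<open>Admissible modules\<close>

lemma kappa_inj_submodule:
  assumes M: "left_module (Aq q) M" and H: "submodule H (Aq q) M"
    and inj: "inj_on (kappa q M) (carrier M)"
  shows "inj_on (kappa q (M\<lparr>carrier := H\<rparr>)) H"
proof (rule inj_onI)
  fix v w assume vw: "v \<in> H" "w \<in> H" "kappa q (M\<lparr>carrier := H\<rparr>) v = kappa q (M\<lparr>carrier := H\<rparr>) w"
  then have "kappa q M v = kappa q M w"
    using kappa_hom[OF left_module_submodule[OF M H] M inclusion_hom[OF M H], of v w] by simp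
  then show "v = w" using inj submoduleD(1)[OF M H] vw(1,2) by (auto dest: inj_onD)
qed

text \<open>By naturality along the projections, vectors with the same image under
  \<open>kappa\<close> have components with the same image; these agree, as \<open>kappa\<close> is
  injective on each summand.\<close>

lemma kappa_inj_direct_sum:
  assumes sum: "direct_sum (Aq q) M I N"
    and inj: "\<And>i. i \<in> I \<Longrightarrow> inj_on (kappa q (M\<lparr>carrier := N i\<rparr>)) (N i)"
  shows "inj_on (kappa q M) (carrier M)"
proof (rule inj_onI)
  fix v w assume vw: "v \<in> carrier M" "w \<in> carrier M" "kappa q M v = kappa q M w"
  have M: "left_module (Aq q) M" and N: "\<And>i. i \<in> I \<Longrightarrow> submodule (N i) (Aq q) M"
    using sum by (auto simp: direct_sum_def)
  interpret left_module "Aq q" M by (rule M)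
  obtain s where s: "\<And>v. v \<in> carrier M \<Longrightarrow> s v \<in> Pi I N \<and> finsum M (s v) I = v"
    and hom: "\<And>i. i \<in> I \<Longrightarrow> (\<lambda>v. s v i) \<in> left_module_hom (Aq q) M (M\<lparr>carrier := N i\<rparr>)"
    using direct_sum_projections[OF sum] by blast
  have eq: "s v i = s w i" if i: "i \<in> I" for i
    using inj_onD[OF inj[OF i] kappa_hom[OF M left_module_submodule[OF M N[OF i]] hom[OF i] vw]]
      s[OF vw(1)] s[OF vw(2)] i by blast
  have "finsum M (s v) I = finsum M (s w) I"
  proof (rule M.finsum_cong')
    show "s w \<in> I \<rightarrow> carrier M" using s[OF vw(2)] submoduleD(1)[OF M N] by blast
  qed (use eq in auto)
  then show "v = w" using s[OF vw(1)] s[OF vw(2)] by simp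
qed

text \<open>The definition of admissibility numbers the submodules from zero; an arbitrary finite
  index set is brought into that form by a bijection.\<close>

lemma admissibleI:
  fixes d :: "'i \<Rightarrow> nat \<times> nat"
  assumes M: "left_module (Aq q) M" and J: "finite J" "carrier M = sum_of M J N"
    and N: "\<And>j. j \<in> J \<Longrightarrow> submodule (N j) (Aq q) M"
      "\<And>j. j \<in> J \<Longrightarrow> d j \<noteq> (0, 0) \<and> catC_tilde q (d j) (M\<lparr>carrier := N j\<rparr>)"
    and inj: "inj_on (kappa q M) (carrier M)"
  shows "admissible q M"
proof -
  interpret left_module "Aq q" M by (rule M)
  obtain h where h: "bij_betw h {..<card J} J"
    using ex_bij_betw_nat_finite[OF J(1)] by (auto simp: lessThan_atLeast0)
  then have hJ: "h j \<in> J" if "j < card J" for j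
    using that by (auto dest: bij_betwE)
  have Nh: "submodule (N (h j)) (Aq q) M" if "j \<in> {..<card J}" for j
    using N(1) hJ that by simp
  have "carrier M \<subseteq> sum_of M {..<card J} (N \<circ> h)"
  proof
    fix v assume "v \<in> carrier M"
    then obtain f where f: "v = finsum M f J" "f \<in> Pi J N" unfolding J(2) sum_of_def by blast
    have "f \<in> J \<rightarrow> carrier M" using f(2) submoduleD(1)[OF M N(1)] by blast
    then have "finsum M f J = finsum M (\<lambda>j. f (h j)) {..<card J}"
      using M.finsum_reindex[of f h "{..<card J}"] h by (simp add: bij_betw_def)
    moreover have "(\<lambda>j. f (h j)) \<in> Pi {..<card J} (N \<circ> h)" using f(2) hJ by auto
    ultimately show "v \<in> sum_of M {..<card J} (N \<circ> h)" unfolding f(1) sum_of_def by blast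
  qed
  moreover have "sum_of M {..<card J} (N \<circ> h) \<subseteq> carrier M"
    using sum_of_closed(1)[OF M, of "{..<card J}" "N \<circ> h"] Nh by simp
  ultimately have "carrier M = sum_of M {..<card J} (N \<circ> h)" by blast
  then show ?thesis
    unfolding admissible_def using M inj N hJ
    by (intro conjI exI[of _ "card J"] exI[of _ "N \<circ> h"] exI[of _ "d \<circ> h"]) auto
qed

lemma admissible_injective:
  "admissible q M \<Longrightarrow> injective_on_module M (qmon q (1, 1))"
  unfolding admissible_def by (intro injective_on_module_if_kappa_inj) auto

lemma catC_torsion_part:
  assumes M: "left_module (Aq q) M" and inj: "inj_on (kappa q M) (carrier M)"
    and p: "p \<in> primitive_pairs"
  shows "catC q p (M\<lparr>carrier := torsion_part q M p\<rparr>)"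
proof -
  interpret qplane_module q M using M by (simp add: qplane_module_def)
  let ?T = "torsion_part q M p"
  let ?M = "M\<lparr>carrier := ?T\<rparr>"
  have T: "left_module (Aq q) ?M"
    by (rule left_module_submodule[OF M submodule_torsion_part])
  interpret T: left_module "Aq q" ?M by (rule T)
  have tilde: "catC_tilde q p ?M"
    using T poly_torsion_torsion_part by (simp add: catC_tilde_iff)
  have sub: "submodule ?T (Aq q) ?M" using submodule_carrier[OF T] by simp
  have "admissible q ?M"
  \<comment> \<open>The torsion part is its own one-term family of submodules.\<close>
  proof (rule admissibleI[OF T, of "{()}" "\<lambda>_. ?T" "\<lambda>_. p"])
    show "carrier ?M = sum_of ?M {()} (\<lambda>_. ?T)"
      using sum_of_closed(1)[OF T, of "{()}" "\<lambda>_. ?T"] sum_of_closed(4)[OF T, of "{()}" "\<lambda>_. ?T" "()"] sub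
      by auto
    show "p \<noteq> (0, 0) \<and> catC_tilde q p (?M\<lparr>carrier := ?T\<rparr>)"
      using p tilde by (auto simp: primitive_pairs_def)
    show "inj_on (kappa q ?M) (carrier ?M)"
      using kappa_inj_submodule[OF M submodule_torsion_part inj] by simp
  qed (use sub in simp_all)
  with tilde show ?thesis by (simp add: catC_def)
qed

text \<open>With \<open>w\<close> all \<open>a w\<close> lie in \<open>N\<close>, where they are
  torsion for a nonzero multiple of the \<open>k\<close>-th power of \<open>D_p\<close>, and so for
  \<open>D_p\<close> itself.\<close>

lemma subset_torsion_part:
  assumes "q \<noteq> 0" and M: "left_module (Aq q) M" and N: "submodule N (Aq q) M"
    and "catC_tilde q (k * fst p, k * snd p) (M\<lparr>carrier := N\<rparr>)" "k > 0"
  shows "N \<subseteq> torsion_part q M p"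
proof
  interpret qplane_module q M using M by (simp add: qplane_module_def)
  obtain c where c: "c \<noteq> 0" "qmon q (k * fst p, k * snd p) = scal q c \<otimes>\<^bsub>Aq q\<^esub> qmon q p [^]\<^bsub>Aq q\<^esub> k"
    using qmon_pow[OF assms(1), of k "fst p" "snd p"] by auto
  fix w assume w: "w \<in> N"
  have "poly_torsion q M (qmon q p) (a \<odot>\<^bsub>M\<^esub> w)" if a: "a \<in> carrier (Aq q)" for a
  proof -
    have "a \<odot>\<^bsub>M\<^esub> w \<in> N" using submoduleD(4)[OF M N a w] .
    then have "poly_torsion q M (scal q c \<otimes>\<^bsub>Aq q\<^esub> qmon q p [^]\<^bsub>Aq q\<^esub> k) (a \<odot>\<^bsub>M\<^esub> w)" "a \<odot>\<^bsub>M\<^esub> w \<in> carrier M"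
      using assms(4) submoduleD(1)[OF M N] by (auto simp: catC_tilde_iff simp flip: c(2))
    then show ?thesis
      using poly_torsion_of_power[OF qmon_closed _ c(1) assms(5)] by blast
  qed
  then show "w \<in> torsion_part q M p"
    using submoduleD(1)[OF M N] w by (auto simp: torsion_part_def)
qed

text \<open>Each submodule from the definition lies in the torsion part of its primitive direction,
  so these torsion parts exhaust \<open>M\<close>; their sum is direct by independence.\<close>

lemma admissible_decomposition:
  assumes q: "q \<noteq> 0" "generic q" and adm: "admissible q M"
  shows "\<exists>F\<subseteq>primitive_pairs. direct_sum (Aq q) M F (torsion_part q M)"
proof -
  obtain k :: nat and N d where M: "left_module (Aq q) M" and car: "carrier M = sum_of M {..<k} N"
    and N: "\<And>j. j < k \<Longrightarrow> submodule (N j) (Aq q) M \<and> d j \<noteq> (0, 0) \<and> catC_tilde q (d j) (M\<lparr>carrier := N j\<rparr>)"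
    using adm unfolding admissible_def by blast
  interpret qplane_module q M using M by (simp add: qplane_module_def)
  have "\<exists>p. j < k \<longrightarrow> p \<in> primitive_pairs \<and> N j \<subseteq> torsion_part q M p" for j
    using primitive_multiple[of "d j"] subset_torsion_part[OF q(1) M, of "N j"] N[of j] by metis
  then obtain p where p: "\<And>j. j < k \<Longrightarrow> p j \<in> primitive_pairs \<and> N j \<subseteq> torsion_part q M (p j)"
    by metis
  \<comment> \<open>Taking the image merges submodules that share a direction, so every torsion part
    occurs once.\<close>
  define F where "F = p ` {..<k}"
  have F: "finite F" "F \<subseteq> primitive_pairs" using p by (auto simp: F_def)
  note closed = sum_of_closed[where I = F and N = "torsion_part q M", OF M submodule_torsion_part]
  have "carrier M \<subseteq> sum_of M F (torsion_part q M)"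
  proof
    fix v assume "v \<in> carrier M"
    then obtain f where f: "v = finsum M f {..<k}" "f \<in> Pi {..<k} N" unfolding car sum_of_def by blast
    show "v \<in> sum_of M F (torsion_part q M)" unfolding f(1)
    proof (rule M.finsum_in)
      show "f j \<in> sum_of M F (torsion_part q M)" if "j \<in> {..<k}" for j
      proof (rule closed(4)[OF F(1), of "p j"])
        show "p j \<in> F" using that by (simp add: F_def)
        show "f j \<in> torsion_part q M (p j)" using that f(2) p by auto
      qed
    qed (use closed in auto)
  qed
  then have "carrier M = sum_of M F (torsion_part q M)" using closed(1) by blast
  then have "direct_sum (Aq q) M F (torsion_part q M)"
    using M F submodule_torsion_part torsion_parts_independent[OF q admissible_injective[OF adm]]
    unfolding direct_sum_def by blast
  then show ?thesis using F(2) by blast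
qed

text \<open>The vector \<open>f v\<close> is torsion for \<open>D_p\<close> as an image of
  \<open>v\<close>, and all of \<open>M'\<close> is torsion for \<open>D_r\<close>. Admissibility of
  \<open>M'\<close> makes monomials injective there, so the two conditions exclude each other unless
  \<open>f v\<close> is zero.\<close>

lemma hom_eq_zero:
  assumes q: "q \<noteq> 0" "generic q" and p: "p \<in> primitive_pairs" "r \<in> primitive_pairs" "p \<noteq> r"
    and M: "catC q p M" "catC q r M'" and f: "f \<in> left_module_hom (Aq q) M M'" and v: "v \<in> carrier M"
  shows "f v = \<zero>\<^bsub>M'\<^esub>"
proof -
  have mods: "left_module (Aq q) M" "left_module (Aq q) M'"
    and tors: "\<And>w. w \<in> carrier M \<Longrightarrow> poly_torsion q M (qmon q p) w"
      "\<And>w. w \<in> carrier M' \<Longrightarrow> poly_torsion q M' (qmon q r) w"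
    using M by (simp_all add: catC_def catC_tilde_iff)
  interpret M: qplane_module q M using mods(1) by (simp add: qplane_module_def)
  interpret M': qplane_module q M' using mods(2) by (simp add: qplane_module_def)
  have fv: "f w \<in> carrier M'" if "w \<in> carrier M" for w using f that by (auto simp: left_module_hom_def)
  have add: "f (\<zero>\<^bsub>M\<^esub> \<oplus>\<^bsub>M\<^esub> \<zero>\<^bsub>M\<^esub>) = f \<zero>\<^bsub>M\<^esub> \<oplus>\<^bsub>M'\<^esub> f \<zero>\<^bsub>M\<^esub>"
    using f M.M.zero_closed unfolding left_module_hom_def by blast
  then have zero: "f \<zero>\<^bsub>M\<^esub> = \<zero>\<^bsub>M'\<^esub>" using fv[OF M.M.zero_closed] by simp
  obtain P where P: "P \<noteq> 0" "poly_act q M (qmon q p) P v = \<zero>\<^bsub>M\<^esub>"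
    using tors(1)[OF v] unfolding poly_torsion_def by blast
  have "poly_act q M' (qmon q p) P (f v) = \<zero>\<^bsub>M'\<^esub>"
    using poly_act_hom[OF mods f qmon_closed v, of p P] P(2) zero by simp
  then have "poly_torsion q M' (qmon q p) (f v)" using P(1) unfolding poly_torsion_def by blast
  moreover have "injective_on_module M' (qmon q (1, 1))"
    using M(2) by (intro admissible_injective) (simp add: catC_def)
  ultimately show ?thesis
    using fv[OF v] tors(2) by (intro M'.poly_torsion_eq_zero[OF q _ p]) auto
qed

text \<open>The equality of categories is split into two inclusions on objects and the vanishing of
  mixed homomorphisms. In the converse inclusion the summands are indexed by numbers, which lets one
  primitive pair occur repeatedly.\<close>

theorem lemma5p3:
  fixes q :: complex
  assumes "q \<noteq> 0" and "generic q"
  shows "(\<forall>M :: (qplane, 'b) module. admissible q M \<longrightarrow>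
            (\<exists>F N. F \<subseteq> primitive_pairs \<and> direct_sum (Aq q) M F N
               \<and> (\<forall>p\<in>F. catC q p (M\<lparr>carrier := N p\<rparr>))))
       \<and> (\<forall>(M :: (qplane, 'b) module) (I :: nat set) N p.
            direct_sum (Aq q) M I N
            \<and> (\<forall>i\<in>I. p i \<in> primitive_pairs \<and> catC q (p i) (M\<lparr>carrier := N i\<rparr>))
            \<longrightarrow> admissible q M)
       \<and> (\<forall>p\<in>primitive_pairs. \<forall>p'\<in>primitive_pairs. p \<noteq> p' \<longrightarrow>
            (\<forall>(M :: (qplane, 'b) module) (M' :: (qplane, 'c) module).
               catC q p M \<and> catC q p' M' \<longrightarrow>
               (\<forall>f\<in>left_module_hom (Aq q) M M'. \<forall>v\<in>carrier M. f v = \<zero>\<^bsub>M'\<^esub>)))"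
proof (intro conjI allI ballI impI)
  fix M :: "(qplane, 'b) module"
  assume adm: "admissible q M"
  then have M: "left_module (Aq q) M" "inj_on (kappa q M) (carrier M)"
    by (simp_all add: admissible_def)
  obtain F where "F \<subseteq> primitive_pairs" "direct_sum (Aq q) M F (torsion_part q M)"
    using admissible_decomposition[OF assms adm] by blast
  then show "\<exists>F N. F \<subseteq> primitive_pairs \<and> direct_sum (Aq q) M F N
      \<and> (\<forall>p\<in>F. catC q p (M\<lparr>carrier := N p\<rparr>))"
    using catC_torsion_part[OF M] by blast
next
  fix M :: "(qplane, 'b) module" and I :: "nat set" and N p
  assume *: "direct_sum (Aq q) M I N
    \<and> (\<forall>i\<in>I. p i \<in> primitive_pairs \<and> catC q (p i) (M\<lparr>carrier := N i\<rparr>))"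
  then have sum: "direct_sum (Aq q) M I N" by blast
  show "admissible q M"
  proof (rule admissibleI[of q M I N p])
    show "left_module (Aq q) M" "finite I" "carrier M = sum_of M I N"
      using sum by (auto simp: direct_sum_def)
    show "submodule (N j) (Aq q) M" if "j \<in> I" for j
      using sum that by (auto simp: direct_sum_def)
    show "p j \<noteq> (0, 0) \<and> catC_tilde q (p j) (M\<lparr>carrier := N j\<rparr>)" if "j \<in> I" for j
      using * that by (auto simp: catC_def primitive_pairs_def)
    show "inj_on (kappa q M) (carrier M)"
      using * by (intro kappa_inj_direct_sum[OF sum]) (auto simp: catC_def admissible_def)
  qed
next
  fix p p' and M :: "(qplane, 'b) module" and M' :: "(qplane, 'c) module" and f v
  assume p: "p \<in> primitive_pairs" "p' \<in> primitive_pairs" "p \<noteq> p'"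
    and C: "catC q p M \<and> catC q p' M'" and f: "f \<in> left_module_hom (Aq q) M M'" "v \<in> carrier M"
  show "f v = \<zero>\<^bsub>M'\<^esub>"
    by (rule hom_eq_zero[OF assms p conjunct1[OF C] conjunct2[OF C] f])
qed

end
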